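(* Let $\mathcal{F}=\{\mathcal{P}(p)\mid p\in\mathbb{R}\setminus\{0\}\}$ be the confocal family of parabolas $\mathcal{P}(p): y^2=2px+p^2$, and let $n\ge 3$ be a natural number. Then there exists a circle $\mathcal{D}\subset\mathbb{R}^2$ such that $\mathcal{F}$ is $n$-isoperiodic with $\mathcal{D}$ if and only if $n\in\{3,4\}$.
   Context: Every parabola $\mathcal{P}(p)$ has focus $(0,0)$ and the $x$-axis as axis of symmetry. Real conics are identified with their complexifications in $\mathbb{CP}^2$, and polygons are taken in $\mathbb{CP}^2$ (vertices and sides may be non-real). For $n\ge 3$ and two smooth conics $\mathcal{C}_1,\mathcal{C}_2$, an $n$-Poncelet polygon is an $n$-gon ($n$ distinct vertices, $n$ distinct side lines) whose vertices lie on $\mathcal{C}_1$ and whose side lines are tangent to $\mathcal{C}_2$; a $k$-gon traversed $m>1$ times is not regarded as an $mk$-gon. The pair $(\mathcal{C}_1,\mathcal{C}_2)$ is an $n$-Poncelet pair if such an $n$-gon exists. A family $\mathcal{F}$ of nondegenerate conics is $n$-isoperiodic with a nondegenerate conic $\mathcal{D}$ if $(\mathcal{D},\mathcal{C})$ is an $n$-Poncelet pair for every nondegenerate conic $\mathcal{C}\in\mathcal{F}$. *)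

theory Defs
  imports "HOL-Analysis.Analysis"
begin

section \<open>The complex projective plane\<close>

definition proportional :: "complex^3 \<Rightarrow> complex^3 \<Rightarrow> bool" where
  "proportional u v \<longleftrightarrow> u \<noteq> 0 \<and> v \<noteq> 0 \<and> (\<exists>c. c \<noteq> 0 \<and> v = c *s u)"

lemma part_equivp_proportional: "part_equivp proportional"
proof (rule part_equivpI)
  show "\<exists>u. proportional u u"
    by (rule exI[of _ "axis 1 1"]) (auto simp: proportional_def axis_eq_0_iff intro!: exI[of _ 1])
  show "symp proportional"
  proof (rule sympI)
    fix u v assume "proportional u v"
    then obtain c where c: "u \<noteq> 0" "v \<noteq> 0" "c \<noteq> 0" "v = c *s u"
      by (auto simp: proportional_def)
    then have "u = inverse c *s v" by (simp add: vec_eq_iff)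
    with c show "proportional v u"
      unfolding proportional_def by (meson nonzero_imp_inverse_nonzero)
  qed
  show "transp proportional"
  proof (rule transpI)
    fix u v w assume "proportional u v" "proportional v w"
    then obtain c d where "u \<noteq> 0" "w \<noteq> 0" "c \<noteq> 0" "d \<noteq> 0" "w = (d * c) *s u"
      by (auto simp: proportional_def vector_smult_assoc)
    then show "proportional u w"
      unfolding proportional_def by (intro conjI exI[of _ "d * c"]) simp_all
  qed
qed

quotient_type cp2 = "complex^3" / partial: proportional
  by (rule part_equivp_proportional)

text \<open>The product below is bilinear, in contrast to the inner product of \<open>complex^3\<close>,
  which is real-valued.\<close>

definition bilin :: "complex^3 \<Rightarrow> complex^3 \<Rightarrow> complex" where
  "bilin u v = (\<Sum>i\<in>UNIV. u $ i * v $ i)"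

lemma bilin_smult:
  "bilin (c *s u) v = c * bilin u v" "bilin u (c *s v) = c * bilin u v"
  by (simp_all add: bilin_def sum_distrib_left mult_ac)

lift_definition on_line :: "complex^3 \<Rightarrow> cp2 \<Rightarrow> bool" is "\<lambda>l v. bilin l v = 0"
  by (auto simp: proportional_def bilin_smult)

definition is_line :: "cp2 set \<Rightarrow> bool" where
  "is_line L \<longleftrightarrow> (\<exists>l. l \<noteq> 0 \<and> L = {P. on_line l P})"

section \<open>Conics\<close>

text \<open>A conic is given by a symmetric matrix \<open>A\<close>, in homogeneous coordinates \<open>(x, y, z)\<close> with
  affine chart \<open>z = 1\<close>; all notions below are invariant under rescaling of \<open>A\<close>.\<close>

definition nondegenerate_conic :: "complex^3^3 \<Rightarrow> bool" where
  "nondegenerate_conic A \<longleftrightarrow> transpose A = A \<and> det A \<noteq> 0"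

lift_definition conjugate_wrt :: "complex^3^3 \<Rightarrow> cp2 \<Rightarrow> cp2 \<Rightarrow> bool"
  is "\<lambda>A u v. bilin (A *v u) v = 0"
  by (auto simp: proportional_def bilin_smult vector_scalar_commute)

definition on_conic :: "complex^3^3 \<Rightarrow> cp2 \<Rightarrow> bool" where
  "on_conic A P \<longleftrightarrow> conjugate_wrt A P P"

text \<open>The gradient of \<open>u \<mapsto> bilin (A *v u) u\<close> at \<open>u\<close> is \<open>2 *s (A *v u)\<close>, so the tangent line of
  a nondegenerate conic at a point \<open>P\<close> consists of the points conjugate to \<open>P\<close>.\<close>

definition tangent_line_at :: "complex^3^3 \<Rightarrow> cp2 \<Rightarrow> cp2 set" where
  "tangent_line_at A P = {Q. conjugate_wrt A P Q}"

definition tangent_to :: "cp2 set \<Rightarrow> complex^3^3 \<Rightarrow> bool" where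
  "tangent_to L A \<longleftrightarrow> (\<exists>P. on_conic A P \<and> L = tangent_line_at A P)"

section \<open>Poncelet polygons and isoperiodicity\<close>

text \<open>\<open>V i\<close> are the vertices and \<open>S i\<close> the side lines, for \<open>i < n\<close>.\<close>

definition polygon :: "nat \<Rightarrow> (nat \<Rightarrow> cp2) \<Rightarrow> (nat \<Rightarrow> cp2 set) \<Rightarrow> bool" where
  "polygon n V S \<longleftrightarrow> inj_on V {..<n} \<and> inj_on S {..<n} \<and>
     (\<forall>i<n. is_line (S i) \<and> V i \<in> S i \<and> V (Suc i mod n) \<in> S i)"

definition poncelet_polygon ::
  "nat \<Rightarrow> complex^3^3 \<Rightarrow> complex^3^3 \<Rightarrow> (nat \<Rightarrow> cp2) \<Rightarrow> (nat \<Rightarrow> cp2 set) \<Rightarrow> bool" where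
  "poncelet_polygon n A B V S \<longleftrightarrow>
     polygon n V S \<and> (\<forall>i<n. on_conic A (V i)) \<and> (\<forall>i<n. tangent_to (S i) B)"

definition poncelet_pair :: "nat \<Rightarrow> complex^3^3 \<Rightarrow> complex^3^3 \<Rightarrow> bool" where
  "poncelet_pair n A B \<longleftrightarrow> 3 \<le> n \<and> nondegenerate_conic A \<and> nondegenerate_conic B \<and>
     (\<exists>V S. poncelet_polygon n A B V S)"

definition isoperiodic :: "nat \<Rightarrow> (complex^3^3) set \<Rightarrow> complex^3^3 \<Rightarrow> bool" where
  "isoperiodic n F D \<longleftrightarrow> nondegenerate_conic D \<and> (\<forall>C\<in>F. nondegenerate_conic C) \<and>
     (\<forall>C\<in>F. poncelet_pair n D C)"

section \<open>Real circles and the confocal parabolas\<close>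

definition complexify :: "real^3^3 \<Rightarrow> complex^3^3" where
  "complexify A = (\<chi> i j. complex_of_real (A $ i $ j))"

definition real_points :: "real^3^3 \<Rightarrow> (real \<times> real) set" where
  "real_points A = {(x, y). (let v = vector [x, y, 1] :: real^3 in (A *v v) \<bullet> v = 0)}"

definition circle :: "real \<Rightarrow> real \<Rightarrow> real \<Rightarrow> real^3^3" where
  "circle a b r = vector [vector [ 1,  0, -a],
                          vector [ 0,  1, -b],
                          vector [-a, -b, a\<^sup>2 + b\<^sup>2 - r\<^sup>2]]"

definition parabola :: "real \<Rightarrow> real^3^3" where
  "parabola p = vector [vector [ 0, 0, -p],
                        vector [ 0, 1,  0],
                        vector [-p, 0, -(p\<^sup>2)]]"

lemma real_points_circle:
  "real_points (circle a b r) = {(x, y). (x - a)\<^sup>2 + (y - b)\<^sup>2 = r\<^sup>2}"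
  by (auto simp: real_points_def circle_def matrix_vector_mult_def inner_vec_def sum_3
      power2_eq_square algebra_simps)

lemma real_points_parabola:
  "real_points (parabola p) = {(x, y). y\<^sup>2 = 2 * p * x + p\<^sup>2}"
  by (auto simp: real_points_def parabola_def matrix_vector_mult_def inner_vec_def sum_3
      power2_eq_square algebra_simps)

lemma nondegenerate_circle: "r \<noteq> 0 \<Longrightarrow> nondegenerate_conic (complexify (circle a b r))"
  by (auto simp: nondegenerate_conic_def complexify_def circle_def transpose_def vec_eq_iff
      forall_3 det_3 power2_eq_square algebra_simps)

lemma nondegenerate_parabola: "p \<noteq> 0 \<Longrightarrow> nondegenerate_conic (complexify (parabola p))"
  by (auto simp: nondegenerate_conic_def complexify_def parabola_def transpose_def vec_eq_iff
      forall_3 det_3 power2_eq_square algebra_simps)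

definition confocal_parabolas :: "(complex^3^3) set" where
  "confocal_parabolas = {complexify (parabola p) | p. p \<noteq> 0}"

end

theory Submission
  imports Defs "HOL-Computational_Algebra.Polynomial"
begin

text \<open>
  Parametrise the circle with centre \<open>a + ib\<close> and radius \<open>r\<close> by the projective line. The chord
  through the points \<open>z\<close>, \<open>w\<close> is determined by \<open>N = z\<^sub>2 w\<^sub>2\<close>, \<open>S = z\<^sub>1 w\<^sub>2 + z\<^sub>2 w\<^sub>1\<close>, \<open>M = z\<^sub>1 w\<^sub>1\<close>, and
  it touches \<open>y\<^sup>2 = 2px + p\<^sup>2\<close> iff \<open>(cN + rS + c'M)(N + M) + 2pMN = 0\<close>, where \<open>c = a + ib\<close>,
  \<open>c' = a - ib\<close>. So a Poncelet polygon is a cycle of a symmetric (2,2)-correspondence.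

  If \<open>cc' = r\<^sup>2\<close>, all cycles have length 3, and if \<open>c = 0\<close>, they have length 4. If \<open>cc' \<noteq> r\<^sup>2\<close>
  and \<open>a \<noteq> 0\<close>, then for \<open>p = a(r\<^sup>2 - cc')/(cc')\<close> two steps of the correspondence amount to an
  involution, so every cycle has length at most 4. There remains \<open>a = 0\<close>, \<open>b \<noteq> 0\<close>. Here one
  computes the correspondences satisfied by vertices two and three steps apart. Those for three and
  for four steps coincide iff a quadratic equation in \<open>p\<^sup>2\<close> holds, and this equation always has a
  positive root: for that \<open>p\<close> a cycle of length at least 5 has length exactly 7. Conversely, a
  cycle of length 7 forces the equation, which fails for some real \<open>p\<close>.
\<close>

section \<open>Symmetric (2,2)-correspondences\<close>

definition wedge :: "complex \<times> complex \<Rightarrow> complex \<times> complex \<Rightarrow> complex" where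
  "wedge x y = fst x * snd y - snd x * fst y"

text \<open>A conic in the plane of unordered pairs of points of the projective line, with
  coordinates \<open>N\<close>, \<open>S\<close>, \<open>M\<close>; \<open>polar\<close> pulls it
  back to a symmetric (2,2)-form.\<close>

definition qform ::
  "complex \<Rightarrow> complex \<Rightarrow> complex \<Rightarrow> complex \<Rightarrow> complex \<Rightarrow> complex \<Rightarrow> complex \<Rightarrow> complex \<Rightarrow> complex \<Rightarrow> complex"
  where "qform a b c d e f N S M = a * N^2 + b * N * S + c * S^2 + d * M * S + e * M^2 + f * M * N"

definition polar :: "(complex \<Rightarrow> complex \<Rightarrow> complex \<Rightarrow> complex) \<Rightarrow> complex \<times> complex \<Rightarrow> complex \<times> complex \<Rightarrow> complex"
  where "polar F x y = F (snd x * snd y) (fst x * snd y + snd x * fst y) (fst x * fst y)"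

definition binary_form :: "complex \<Rightarrow> complex \<Rightarrow> complex \<Rightarrow> complex \<times> complex \<Rightarrow> complex" where
  "binary_form A B C x = A * fst x ^ 2 + B * fst x * snd x + C * snd x ^ 2"

lemma polar_commute: "polar F x y = polar F y x"
  by (simp add: polar_def mult.commute add.commute)

lemma polar_qform:
  "polar (qform a b c d e f) x y =
     binary_form (binary_form e d c x) (binary_form d (f + 2 * c) b x) (binary_form c b a x) y"
  unfolding polar_def qform_def binary_form_def by algebra

text \<open>The product of the three wedges is a homogeneous Vandermonde determinant, and it
  annihilates each coefficient.\<close>

lemma binary_three_roots:
  assumes "binary_form A B C x = 0" "binary_form A B C y = 0" "binary_form A B C z = 0"
    and "wedge x y \<noteq> 0" "wedge x z \<noteq> 0" "wedge y z \<noteq> 0"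
  shows "A = 0" "B = 0" "C = 0"
proof -
  have "wedge x y * wedge x z * wedge y z * A = 0" "wedge x y * wedge x z * wedge y z * B = 0"
    "wedge x y * wedge x z * wedge y z * C = 0"
    using assms(1-3) unfolding binary_form_def wedge_def by algebra+
  then show "A = 0" "B = 0" "C = 0" using assms(4-6) by auto
qed

text \<open>Vieta on the projective line; \<open>\<nu> = 0\<close> accounts for the zero
  form.\<close>

lemma binary_two_roots:
  assumes "binary_form A B C x = 0" "binary_form A B C y = 0" "wedge x y \<noteq> 0"
  obtains \<nu> where "A = \<nu> * (snd x * snd y)" "- B = \<nu> * (fst x * snd y + snd x * fst y)"
    "C = \<nu> * (fst x * fst y)"
proof -
  obtain x1 x2 y1 y2 where xy: "x = (x1, x2)" "y = (y1, y2)" by fastforce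
  define N S M where "N = x2 * y2" and "S = x1 * y2 + x2 * y1" and "M = x1 * y1"
  have w: "x1 * y2 - x2 * y1 \<noteq> 0" using assms(3) by (simp add: xy wedge_def)
  have "(x1 * y2 - x2 * y1) * (A * S + B * N) = 0" "(x1 * y2 - x2 * y1) * (C * S + B * M) = 0"
    "(x1 * y2 - x2 * y1) * (C * N - A * M) = 0"
    using assms(1,2) unfolding binary_form_def N_def S_def M_def xy fst_conv snd_conv by algebra+
  then have e: "A * S + B * N = 0" "C * S + B * M = 0" "C * N = A * M" using w by auto
  have "N \<noteq> 0 \<or> S \<noteq> 0 \<or> M \<noteq> 0"
    using w unfolding N_def S_def M_def by (cases "x1 = 0"; cases "x2 = 0"; cases "y1 = 0"; cases "y2 = 0") auto
  then consider "N \<noteq> 0" | "S \<noteq> 0" | "M \<noteq> 0" by blast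
  then have "\<exists>\<nu>. A = \<nu> * N \<and> - B = \<nu> * S \<and> C = \<nu> * M"
  proof cases
    case 1 with e show ?thesis
      by (intro exI[of _ "A / N"]) (simp add: field_simps add_eq_0_iff)
  next
    case 2
    have "A * S = - B * N" "C * S = - B * M" using e by algebra+
    with 2 show ?thesis by (intro exI[of _ "- B / S"]) (simp add: field_simps)
  next
    case 3
    have "C * S = - B * M" using e by algebra
    with 3 e show ?thesis by (intro exI[of _ "C / M"]) (simp add: field_simps)
  qed
  with that show thesis unfolding N_def S_def M_def xy by auto
qed

text \<open>The two sides differ by the resultant of the two forms, which vanishes at a common
  zero.\<close>

lemma binary_resultant:
  assumes "binary_form A B C x = 0" "binary_form A' B' C' x = 0" "x \<noteq> (0, 0)"
  shows "(A * C' - A' * C)^2 = (A * B' - A' * B) * (B * C' - B' * C)"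
proof -
  obtain x1 x2 where x: "x = (x1, x2)" by fastforce
  have "x1^4 * ((A * C' - A' * C)^2 - (A * B' - A' * B) * (B * C' - B' * C)) = 0"
    "x2^4 * ((A * C' - A' * C)^2 - (A * B' - A' * B) * (B * C' - B' * C)) = 0"
    using assms(1,2) unfolding binary_form_def x fst_conv snd_conv by algebra+
  then show ?thesis using assms(3) x by auto
qed

text \<open>Cramer's rule. The unknowns will be \<open>fst x ^ 2\<close>,
  \<open>fst x * snd x\<close>, \<open>snd x ^ 2\<close>, so the first and the third suffice to
  conclude \<open>x = (0, 0)\<close>.\<close>

lemma linear_system_det:
  fixes u v w :: complex
  assumes "a1 * u + b1 * v + c1 * w = 0" "a2 * u + b2 * v + c2 * w = 0" "a3 * u + b3 * v + c3 * w = 0"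
    and "a1 * (b2 * c3 - b3 * c2) - b1 * (a2 * c3 - a3 * c2) + c1 * (a2 * b3 - a3 * b2) \<noteq> 0"
  shows "u = 0" "w = 0"
proof -
  let ?d = "a1 * (b2 * c3 - b3 * c2) - b1 * (a2 * c3 - a3 * c2) + c1 * (a2 * b3 - a3 * b2)"
  have "?d * u = 0" "?d * w = 0" using assms(1-3) by algebra+
  with assms(4) show "u = 0" "w = 0" by auto
qed

text \<open>Periodic indexing by all naturals makes stepping free of reductions modulo
  \<open>n\<close>; nonzero wedges express distinct points of the projective line.\<close>

definition poncelet_cycle where
  "poncelet_cycle F n z \<longleftrightarrow> (\<forall>i j. i mod n \<noteq> j mod n \<longrightarrow> wedge (z i) (z j) \<noteq> 0) \<and>
     (\<forall>i. polar F (z i) (z (Suc i)) = 0) \<and> (\<forall>i. z (i + n) = z i)"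

lemma poncelet_cycle_wedge:
  assumes "poncelet_cycle F n z" "\<not> n dvd k"
  shows "wedge (z i) (z (i + k)) \<noteq> 0" "wedge (z (i + k)) (z i) \<noteq> 0"
proof -
  have "i mod n \<noteq> (i + k) mod n"
    using assms(2) by (metis add_diff_cancel_left' le_add1 mod_eq_dvd_iff_nat)
  with assms(1) show "wedge (z i) (z (i + k)) \<noteq> 0" "wedge (z (i + k)) (z i) \<noteq> 0"
    unfolding poncelet_cycle_def by metis+
qed

lemma wedge_nonzero: "wedge x y \<noteq> 0 \<Longrightarrow> x \<noteq> (0, 0) \<and> y \<noteq> (0, 0)"
  by (auto simp: wedge_def)

lemma qform_scale: "qform a b c d e f (k * N) (k * S) (k * M) = k\<^sup>2 * qform a b c d e f N S M"
  unfolding qform_def by algebra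

text \<open>Both neighbours of \<open>y\<close> are zeros of one binary form with coefficients
  quadratic in \<open>y\<close>, so Vieta yields their pair coordinates up to a factor. With
  \<open>qform_polar\<close>, composing a correspondence with itself becomes a substitution.\<close>

lemma polar_neighbours:
  assumes "polar (qform a b c d e f) x y = 0" "polar (qform a b c d e f) y z = 0" "wedge x z \<noteq> 0"
    and "A = binary_form e d c y" "B = binary_form d (f + 2 * c) b y" "C = binary_form c b a y"
  obtains \<nu> where "A = \<nu> * (snd x * snd z)" "- B = \<nu> * (fst x * snd z + snd x * fst z)"
    "C = \<nu> * (fst x * fst z)"
proof -
  have "binary_form A B C x = 0" "binary_form A B C z = 0"
    using assms(1,2) polar_commute[of _ x y] by (simp_all add: assms(4-6) polar_qform)
  then obtain \<nu> where \<nu>: "A = \<nu> * (snd x * snd z)" "- B = \<nu> * (fst x * snd z + snd x * fst z)"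
    "C = \<nu> * (fst x * fst z)" using binary_two_roots assms(3) by metis
  with that show thesis by blast
qed

lemma qform_polar:
  assumes "A = \<nu> * (snd x * snd z)" "- B = \<nu> * (fst x * snd z + snd x * fst z)" "C = \<nu> * (fst x * fst z)"
  shows "qform a b c d e f A (- B) C = \<nu>\<^sup>2 * polar (qform a b c d e f) x z"
  unfolding assms qform_scale polar_def ..

section \<open>Cycles of length at most four\<close>

text \<open>The condition that a chord of the circle is tangent to the parabola, with
  \<open>c = a + ib\<close>, \<open>c' = a - ib\<close>.\<close>

definition side_form where
  "side_form c c' r p = qform c r 0 r c' (c + c' + 2 * p)"

text \<open>The first condition on \<open>c\<close> puts the focus on the circle. Then the two
  neighbours of a vertex are neighbours of each other, so \<open>z 2\<close> would have the three
  neighbours \<open>z 0\<close>, \<open>z 1\<close>, \<open>z 3\<close>.\<close>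

lemma side_form_zero_path:
  assumes path: "poncelet_cycle (side_form c c' r p) n z" and n: "4 \<le> n"
    and c: "c * c' = r\<^sup>2" "r \<noteq> 0" "p \<noteq> 0"
  shows False
proof -
  note w = poncelet_cycle_wedge[OF path]
  have nd: "\<not> n dvd 1" "\<not> n dvd 2" "\<not> n dvd 3" using n by (auto dest: dvd_imp_le)
  define A where "A y = binary_form c' r 0 y" for y
  define B where "B y = binary_form r (c + c' + 2 * p) r y" for y
  define C where "C y = binary_form 0 r c y" for y
  have step: "polar (side_form c c' r p) (z i) (z (Suc i)) = 0" for i
    using path by (simp add: poncelet_cycle_def)
  have rows: "polar (side_form c c' r p) x y = binary_form (A x) (B x) (C x) y" for x y
    by (simp add: side_form_def polar_qform A_def B_def C_def)
  have nz: "\<not> (A y = 0 \<and> B y = 0 \<and> C y = 0)" if "y \<noteq> (0, 0)" for y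
  proof
    assume "A y = 0 \<and> B y = 0 \<and> C y = 0"
    then have "c' * fst y ^ 2 + r * (fst y * snd y) + 0 * snd y ^ 2 = 0"
      "r * fst y ^ 2 + (c + c' + 2 * p) * (fst y * snd y) + r * snd y ^ 2 = 0"
      "0 * fst y ^ 2 + r * (fst y * snd y) + c * snd y ^ 2 = 0"
      by (auto simp: A_def B_def C_def binary_form_def algebra_simps)
    note l = linear_system_det[OF this]
    \<comment> \<open>This is the determinant of the system in the three monomials of
      \<open>y\<close>.\<close>
    have "c' * ((c + c' + 2 * p) * c - r * r) - r * (r * c - 0 * r) + 0 * (r * r - 0 * (c + c' + 2 * p)) = 2 * p * r\<^sup>2"
      using c(1) by algebra
    then have "fst y ^ 2 = 0" "snd y ^ 2 = 0" using l c(2,3) by auto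
    with that show False by (cases y) auto
  qed
  have z0: "z i \<noteq> (0, 0)" for i using w(1)[OF nd(1)] wedge_nonzero by blast
  have "polar (side_form c c' r p) (z 0) (z 2) = 0"
  proof -
    define y where "y = z 1"
    obtain \<nu> where \<nu>: "A y = \<nu> * (snd (z 0) * snd (z 2))"
      "- B y = \<nu> * (fst (z 0) * snd (z 2) + snd (z 0) * fst (z 2))"
      "C y = \<nu> * (fst (z 0) * fst (z 2))"
      by (rule polar_neighbours[of c r 0 r c' "c + c' + 2 * p" "z 0" y "z 2"])
        (use step[of 0] step[of 1] w(1)[OF nd(2), of 0] in
          \<open>simp_all add: side_form_def A_def B_def C_def y_def numeral_2_eq_2\<close>)
    have "\<nu> \<noteq> 0" using nz[OF z0[of 1]] \<nu>(1-3) by (auto simp: y_def)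
    moreover have "side_form c c' r p (A y) (- B y) (C y) = 0"
      unfolding side_form_def A_def B_def C_def qform_def binary_form_def using c(1) by algebra
    ultimately show ?thesis using qform_polar[OF \<nu>] unfolding side_form_def by simp
  qed
  then have roots: "binary_form (A (z 2)) (B (z 2)) (C (z 2)) (z 0) = 0"
    "binary_form (A (z 2)) (B (z 2)) (C (z 2)) (z 1) = 0" "binary_form (A (z 2)) (B (z 2)) (C (z 2)) (z 3) = 0"
    using step[of 1] step[of 2] polar_commute[of _ "z 2"]
    unfolding rows[symmetric] by (simp_all add: numeral_2_eq_2 numeral_3_eq_3)
  have "wedge (z 0) (z 1) \<noteq> 0" "wedge (z 0) (z 3) \<noteq> 0" "wedge (z 1) (z 3) \<noteq> 0"
    using w(1)[OF nd(1), of 0] w(1)[OF nd(3), of 0] w(1)[OF nd(2), of 1] by (simp_all add: numeral_3_eq_3)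
  then show False
    using binary_three_roots[OF roots] nz[OF z0[of 2]] by blast
qed

text \<open>By Vieta, \<open>lin\<close> becomes a symmetric bilinear relation between
  \<open>z i\<close> and \<open>z (i + 2)\<close>. By \<open>nondeg\<close> it is the graph of an
  involution, so \<open>z 4\<close> would coincide with \<open>z 0\<close>.\<close>

lemma side_form_involution_path:
  assumes path: "poncelet_cycle (side_form c c' r p) n z" and n: "5 \<le> n"
    and c: "c * c' \<noteq> r\<^sup>2" "r \<noteq> 0"
    and lin: "\<And>y. \<alpha> * binary_form c' r 0 y - \<beta> * binary_form r (c + c' + 2 * p) r y + \<gamma> * binary_form 0 r c y = 0"
    and nondeg: "\<alpha> * \<gamma> \<noteq> \<beta>\<^sup>2"
  shows False
proof -
  note w = poncelet_cycle_wedge[OF path]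
  have nd: "\<not> n dvd 1" "\<not> n dvd 2" "\<not> n dvd 4" using n by (auto dest: dvd_imp_le)
  have step: "polar (side_form c c' r p) (z i) (z (Suc i)) = 0" for i
    using path by (simp add: poncelet_cycle_def)
  have z0: "z i \<noteq> (0, 0)" for i using w(1)[OF nd(1)] wedge_nonzero by blast
  have L: "\<alpha> * (snd (z i) * snd (z (i + 2))) + \<beta> * (fst (z i) * snd (z (i + 2)) + snd (z i) * fst (z (i + 2)))
    + \<gamma> * (fst (z i) * fst (z (i + 2))) = 0" for i
  proof -
    define y where "y = z (Suc i)"
    obtain \<nu> where \<nu>: "binary_form c' r 0 y = \<nu> * (snd (z i) * snd (z (i + 2)))"
      "- binary_form r (c + c' + 2 * p) r y = \<nu> * (fst (z i) * snd (z (i + 2)) + snd (z i) * fst (z (i + 2)))"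
      "binary_form 0 r c y = \<nu> * (fst (z i) * fst (z (i + 2)))"
      by (rule polar_neighbours[of c r 0 r c' "c + c' + 2 * p" "z i" y "z (i + 2)"])
        (use step[of i] step[of "Suc i"] w(1)[OF nd(2), of i] in \<open>simp_all add: side_form_def y_def\<close>)
    have "\<nu> \<noteq> 0"
    proof
      assume "\<nu> = 0"
      then have "binary_form c' r 0 y = 0" "binary_form r (c + c' + 2 * p) r y = 0" "binary_form 0 r c y = 0"
        using \<nu> by auto
      then have "fst y * (c' * fst y + r * snd y) = 0" "snd y * (r * fst y + c * snd y) = 0"
        "r * fst y ^ 2 + (c + c' + 2 * p) * (fst y * snd y) + r * snd y ^ 2 = 0"
        by (simp_all add: binary_form_def power2_eq_square algebra_simps)
      moreover have "fst y \<noteq> 0 \<or> snd y \<noteq> 0" using z0[of "Suc i"] by (simp add: y_def prod_eq_iff)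
      \<comment> \<open>The middle form excludes a zero coordinate; what remains is a linear system
        with determinant \<open>c * c' - r^2\<close>.\<close>
      ultimately have "c' * fst y + r * snd y = 0" "r * fst y + c * snd y = 0" "fst y \<noteq> 0"
        using c(2) by auto
      moreover from this have "(c * c' - r\<^sup>2) * fst y = 0" by algebra
      ultimately show False using c(1) by simp
    qed
    moreover have "\<nu> * (\<alpha> * (snd (z i) * snd (z (i + 2))) + \<beta> * (fst (z i) * snd (z (i + 2))
      + snd (z i) * fst (z (i + 2))) + \<gamma> * (fst (z i) * fst (z (i + 2)))) = 0"
      using lin[of y] \<nu> by algebra
    ultimately show ?thesis by simp
  qed
  have L': "\<alpha> * (snd (z 2) * snd (z 4)) + \<beta> * (fst (z 2) * snd (z 4) + snd (z 2) * fst (z 4))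
    + \<gamma> * (fst (z 2) * fst (z 4)) = 0" using L[of 2] by simp
  \<comment> \<open>The relation with \<open>z 2\<close> is linear in the other point and holds for
    both \<open>z 0\<close> and \<open>z 4\<close>.\<close>
  have "wedge (z 0) (z 4) * ((\<alpha> * \<gamma> - \<beta>\<^sup>2) * fst (z 2)) = 0"
    "wedge (z 0) (z 4) * ((\<alpha> * \<gamma> - \<beta>\<^sup>2) * snd (z 2)) = 0"
    using L[of 0] L' unfolding wedge_def add_0 by algebra+
  moreover have "wedge (z 0) (z 4) \<noteq> 0" using w(1)[OF nd(3), of 0] by simp
  ultimately show False using z0[of 2] nondeg by (simp add: prod_eq_iff)
qed

section \<open>Centres off the axis of symmetry\<close>

text \<open>\<open>axial1\<close> is the tangency condition for \<open>a = 0\<close>, normalised by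
  \<open>z\<^sub>1 \<mapsto> iz\<^sub>1\<close>, \<open>b \<mapsto> b/r\<close>, \<open>h = 2ip/r\<close>. The pair of neighbours of \<open>z\<close> depends quadratically on \<open>z\<close>, and
  \<open>axial2\<close> is the implicit equation of the conic it describes, i.e. the condition on vertices two steps
  apart. \<open>axial3\<close>, for three steps, is the cofactor of \<open>axial1\<close> in the resultant of \<open>axial1\<close> and
  \<open>axial2\<close> (see \<open>axial_res\<close>).\<close>

definition axial1 where "axial1 b h = qform b 1 0 (-1) (- b) h"

definition axial2 where "axial2 b h = (let R = 1 - b^2 in
  qform (h * b - R) (h * b^2 - 2 * R * b) (- R * b^2) (- h * b^2 - 2 * R * b) (- h * b - R)
    (h^2 * b^2 - 2 * R))"

definition axial3 where "axial3 b h = (let R = 1 - b^2 in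
  qform (b * R^2 * (R^2 - b * h)) (R^2 * (R^2 - b^2 * h^2 - 2 * b^3 * h))
    (b^2 * h * (b^2 * h^2 - R^2)) (R^2 * (b^2 * h^2 - R^2 - 2 * b^3 * h))
    (- b * R^2 * (R^2 + b * h)) (h * (R^2 * (1 - 3 * b^4) - b^2 * h^2 * (1 + b^2)^2)))"

lemma axial_double:
  assumes "A = binary_form (- b) (-1) 0 x" "B = binary_form (-1) h 1 x" "C = binary_form 0 1 b x"
  shows "axial2 b h A (- B) C = 0"
  unfolding assms axial2_def Let_def qform_def binary_form_def by algebra

definition theta where "theta b h x =
  b * ((1 - b^2)^2 + b * h) * fst x^4
  + (2 * (1 - b^2)^2 - 2 * b^2 * h^2 + 4 * b^3 * h) * fst x^3 * snd x
  + h * (b^2 * h^2 + 4 * b^2 + 3 * b^4 - 1) * fst x^2 * snd x^2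
  + (- 2 * (1 - b^2)^2 + 2 * b^2 * h^2 + 4 * b^3 * h) * fst x * snd x^3
  - b * ((1 - b^2)^2 - b * h) * snd x^4"

text \<open>Up to a factor, \<open>A\<close>, \<open>- B\<close>, \<open>C\<close> are the pair
  coordinates of the vertices two steps before and two steps after \<open>x\<close>. These are four
  steps apart, and the first factor on the right is \<open>heptagon\<close>.\<close>

lemma axial_theta:
  assumes "R = 1 - b^2"
    "A = binary_form (- h * b - R) (- h * b^2 - 2 * R * b) (- R * b^2) x"
    "B = binary_form (- h * b^2 - 2 * R * b) (h^2 * b^2 - 2 * R - 2 * R * b^2) (h * b^2 - 2 * R * b) x"
    "C = binary_form (- R * b^2) (h * b^2 - 2 * R * b) (h * b - R) x"
  shows "axial3 b h A (- B) C = (b^6 * h^4 + b^2 * R^3 * h^2 - R^6) * theta b h x"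
  unfolding assms axial3_def theta_def Let_def qform_def binary_form_def by algebra

text \<open>A common zero of the two forms is two steps from \<open>x\<close> and one step from
  \<open>y\<close>. So \<open>y\<close> is one or three steps from \<open>x\<close>, which explains
  the two factors.\<close>

lemma axial_res:
  assumes "R = 1 - b^2"
    "A = binary_form (- h * b - R) (- h * b^2 - 2 * R * b) (- R * b^2) x"
    "B = binary_form (- h * b^2 - 2 * R * b) (h^2 * b^2 - 2 * R - 2 * R * b^2) (h * b^2 - 2 * R * b) x"
    "C = binary_form (- R * b^2) (h * b^2 - 2 * R * b) (h * b - R) x"
   "A' = binary_form (- b) (-1) 0 y" "B' = binary_form (-1) h 1 y" "C' = binary_form 0 1 b y"
 shows "(A * C' - A' * C)^2 - (A * B' - A' * B) * (B * C' - B' * C) = polar (axial1 b h) x y * polar (axial3 b h) x y"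
  unfolding assms axial1_def axial3_def polar_def Let_def qform_def binary_form_def by algebra

text \<open>The conditions for three and four steps agree iff this vanishes; see \<open>axial_theta\<close>.\<close>

definition heptagon where "heptagon b h = b^6 * h^4 + b^2 * (1 - b^2)^3 * h^2 - (1 - b^2)^6"

text \<open>The system in the monomials of \<open>x\<close> has determinant \<open>- D\<close>, and
  \<open>D\<close> has no common zero with \<open>heptagon\<close> under the hypotheses.\<close>

lemma axial2_rows_nonzero:
  assumes "heptagon b h = 0" "b \<noteq> 0" "R \<noteq> 0" "R = 1 - b^2"
    "binary_form (- h * b - R) (- h * b^2 - 2 * R * b) (- R * b^2) x = 0"
    "binary_form (- h * b^2 - 2 * R * b) (h^2 * b^2 - 2 * R - 2 * R * b^2) (h * b^2 - 2 * R * b) x = 0"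
    "binary_form (- R * b^2) (h * b^2 - 2 * R * b) (h * b - R) x = 0"
  shows "x = (0, 0)"
proof -
  have l: "(- h * b - R) * fst x ^ 2 + (- h * b^2 - 2 * R * b) * (fst x * snd x) + (- R * b^2) * snd x ^ 2 = 0"
    "(- h * b^2 - 2 * R * b) * fst x ^ 2 + (h^2 * b^2 - 2 * R - 2 * R * b^2) * (fst x * snd x) + (h * b^2 - 2 * R * b) * snd x ^ 2 = 0"
    "(- R * b^2) * fst x ^ 2 + (h * b^2 - 2 * R * b) * (fst x * snd x) + (h * b - R) * snd x ^ 2 = 0"
    using assms(5-7) by (simp_all add: binary_form_def mult.assoc)
  define D where "D = b^4 * h^4 - b^2 * R^3 * (3 + b^2) * h^2 + 2 * R^6"
  have D: "(- h * b - R) * ((h^2 * b^2 - 2 * R - 2 * R * b^2) * (h * b - R) - (h * b^2 - 2 * R * b) * (h * b^2 - 2 * R * b))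
    - (- h * b^2 - 2 * R * b) * ((- h * b^2 - 2 * R * b) * (h * b - R) - (- R * b^2) * (h * b^2 - 2 * R * b))
    + (- R * b^2) * ((- h * b^2 - 2 * R * b) * (h * b^2 - 2 * R * b) - (- R * b^2) * (h^2 * b^2 - 2 * R - 2 * R * b^2)) = - D"
    unfolding D_def assms(4) by algebra
  have "D \<noteq> 0"
  proof
    assume "D = 0"
    define k where "k = 1 + 3 * b^2 + b^4"
    have psi: "b^6 * h^4 + b^2 * R^3 * h^2 = R^6" using assms(1,4) by (simp add: heptagon_def)
    \<comment> \<open>Subtracting \<open>psi\<close> from \<open>b^2\<close> times
      \<open>D = 0\<close> removes \<open>h^4\<close>; the resulting value of \<open>h^2\<close> is
      then put back into \<open>psi\<close>.\<close>
    have "R^3 * (b^2 * k * h^2 - (1 + 2 * b^2) * R^3) = 0"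
      using \<open>D = 0\<close> psi unfolding D_def k_def by algebra
    then have "b^2 * k * h^2 = (1 + 2 * b^2) * R^3" using assms(3) by simp
    then have "b^2 * (1 + 2 * b^2)^2 * R^6 + (1 + 2 * b^2) * k * R^6 = k^2 * R^6" using psi by algebra
    then have "b^8 * R^6 = 0" unfolding k_def by algebra
    with assms(2,3) show False by simp
  qed
  then have "fst x ^ 2 = 0" "snd x ^ 2 = 0" using linear_system_det[OF l, unfolded D] by simp_all
  then show ?thesis by (simp add: prod_eq_iff)
qed

text \<open>Two steps come from Vieta, three from the resultant of one and two steps, and four from
  applying Vieta to the two-step correspondence. In a cycle of length 7, four steps forward are
  three steps back.\<close>

lemma axial_path:
  assumes path: "poncelet_cycle (axial1 b h) n z" and n: "5 \<le> n" and "b \<noteq> 0" "h \<noteq> 0"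
  shows axial_path_2: "polar (axial2 b h) (z i) (z (i + 2)) = 0"
    and axial_path_3: "polar (axial3 b h) (z i) (z (i + 3)) = 0"
    and axial_path_4: "heptagon b h = 0 \<Longrightarrow> 1 - b^2 \<noteq> 0 \<Longrightarrow> polar (axial3 b h) (z i) (z (i + 4)) = 0"
    and axial_path_theta: "n = 7 \<Longrightarrow> heptagon b h * theta b h (z (i + 2)) = 0"
proof -
  note w = poncelet_cycle_wedge[OF path]
  have nd: "\<not> n dvd 1" "\<not> n dvd 2" "\<not> n dvd 3" "\<not> n dvd 4" using n by (auto dest: dvd_imp_le)
  have step: "polar (axial1 b h) (z i) (z (Suc i)) = 0" for i
    using path by (simp add: poncelet_cycle_def)
  have z0: "z i \<noteq> (0, 0)" for i using w(1)[OF nd(1)] wedge_nonzero by blast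
  define A where "A y = binary_form (- b) (-1) 0 y" for y
  define B where "B y = binary_form (-1) h 1 y" for y
  define C where "C y = binary_form 0 1 b y" for y
  have rows: "polar (axial1 b h) x y = binary_form (A x) (B x) (C x) y" for x y
    by (simp add: axial1_def polar_qform A_def B_def C_def)
  have nz: "\<not> (A y = 0 \<and> B y = 0 \<and> C y = 0)" if "y \<noteq> (0, 0)" for y
  proof
    assume "A y = 0 \<and> B y = 0 \<and> C y = 0"
    then have "- b * fst y ^ 2 + (-1) * (fst y * snd y) + 0 * snd y ^ 2 = 0"
      "(-1) * fst y ^ 2 + h * (fst y * snd y) + 1 * snd y ^ 2 = 0"
      "0 * fst y ^ 2 + 1 * (fst y * snd y) + b * snd y ^ 2 = 0"
      by (auto simp: A_def B_def C_def binary_form_def algebra_simps)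
    note l = linear_system_det[OF this]
    have "- b * (h * b - 1 * 1) - (-1) * ((-1) * b - 0 * 1) + 0 * ((-1) * 1 - 0 * h) = - h * b\<^sup>2"
      by algebra
    then have "fst y ^ 2 = 0" "snd y ^ 2 = 0" using l assms(3,4) by auto
    with that show False by (simp add: prod_eq_iff)
  qed
  define R where "R = 1 - b^2"
  define A2 where "A2 y = binary_form (- h * b - R) (- h * b^2 - 2 * R * b) (- R * b^2) y" for y
  define B2 where "B2 y = binary_form (- h * b^2 - 2 * R * b) (h^2 * b^2 - 2 * R - 2 * R * b^2) (h * b^2 - 2 * R * b) y" for y
  define C2 where "C2 y = binary_form (- R * b^2) (h * b^2 - 2 * R * b) (h * b - R) y" for y
  note axial2 = axial2_def[of b h, folded R_def, unfolded Let_def]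
  have rows2: "polar (axial2 b h) x y = binary_form (A2 x) (B2 x) (C2 x) y" for x y
    by (simp add: axial2 polar_qform A2_def B2_def C2_def algebra_simps)
  have path2: "polar (axial2 b h) (z i) (z (i + 2)) = 0" for i
  proof -
    define y where "y = z (Suc i)"
    obtain \<nu> where \<nu>: "A y = \<nu> * (snd (z i) * snd (z (i + 2)))"
      "- B y = \<nu> * (fst (z i) * snd (z (i + 2)) + snd (z i) * fst (z (i + 2)))"
      "C y = \<nu> * (fst (z i) * fst (z (i + 2)))"
      by (rule polar_neighbours[of b 1 0 "-1" "- b" h "z i" y "z (i + 2)"])
        (use step[of i] step[of "Suc i"] w(1)[OF nd(2), of i] in
          \<open>simp_all add: axial1_def y_def A_def B_def C_def\<close>)
    have "\<nu> \<noteq> 0" using nz[OF z0[of "Suc i"]] \<nu> by (auto simp: y_def)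
    moreover have "axial2 b h (A y) (- B y) (C y) = 0"
      by (rule axial_double) (simp_all add: A_def B_def C_def)
    ultimately show ?thesis using qform_polar[OF \<nu>] by (simp add: axial2)
  qed
  then show "polar (axial2 b h) (z i) (z (i + 2)) = 0" .
  have path3: "polar (axial3 b h) (z i) (z (i + 3)) = 0" for i
  proof -
    let ?x = "z i" and ?y = "z (i + 3)" and ?v = "z (i + 2)"
    have "binary_form (A2 ?x) (B2 ?x) (C2 ?x) ?v = 0" using path2[of i] by (simp add: rows2)
    moreover have "binary_form (A ?y) (B ?y) (C ?y) ?v = 0"
      using step[of "i + 2"] polar_commute[of _ ?y] by (simp add: rows[symmetric] numeral_3_eq_3)
    ultimately have "polar (axial1 b h) ?x ?y * polar (axial3 b h) ?x ?y = 0"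
      using binary_resultant[OF _ _ z0[of "i + 2"]]
        axial_res[OF R_def A2_def B2_def C2_def A_def B_def C_def, of ?x ?y] by simp
    moreover have "polar (axial1 b h) ?x ?y \<noteq> 0"
    proof
      assume e: "polar (axial1 b h) ?x ?y = 0"
      \<comment> \<open>The predecessor of \<open>z i\<close>. If \<open>axial1\<close> vanished,
        \<open>z i\<close> would have a third neighbour \<open>z (i + 3)\<close>, distinct from the
        others as \<open>n \<ge> 5\<close>.\<close>
      let ?w = "z (i + (n - 1))"
      have idx: "i + 3 + (n - 4) = i + (n - 1)" "i + 1 + (n - 2) = i + (n - 1)" using n by simp_all
      have "polar (axial1 b h) ?x ?w = 0"
        using step[of "i + (n - 1)"] path n polar_commute[of _ ?x] by (simp add: poncelet_cycle_def)
      moreover have "wedge (z (i + 1)) ?y \<noteq> 0" using w(1)[OF nd(2), of "i + 1"] by (simp add: numeral_3_eq_3)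
      moreover have "\<not> n dvd (n - 4)" "\<not> n dvd (n - 2)" using n by (auto dest: dvd_imp_le)
      then have "wedge ?y ?w \<noteq> 0" "wedge (z (i + 1)) ?w \<noteq> 0"
        using w(1)[of "n - 4" "i + 3"] w(1)[of "n - 2" "i + 1"] idx by metis+
      ultimately have "A ?x = 0" "B ?x = 0" "C ?x = 0"
        using e step[of i] binary_three_roots[of "A ?x" "B ?x" "C ?x" "z (i + 1)" ?y ?w] by (simp_all add: rows)
      then show False using nz[OF z0[of i]] by blast
    qed
    ultimately show ?thesis by simp
  qed
  then show "polar (axial3 b h) (z i) (z (i + 3)) = 0" .
  obtain c0 c1 c2 c3 c4 c5 where ax3: "axial3 b h = qform c0 c1 c2 c3 c4 c5"
    unfolding axial3_def Let_def by blast
  {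
    fix i
    define y where "y = z (i + 2)"
    have B2': "B2 y = binary_form (- h * b^2 - 2 * R * b) (h^2 * b^2 - 2 * R + 2 * (- R * b^2)) (h * b^2 - 2 * R * b) y"
      by (simp add: B2_def mult.assoc)
    have "z (i + 4) = z (i + 2 + 2)" by (simp add: numeral_eq_Suc)
    note path2' = path2[of i, unfolded axial2, folded y_def] path2[of "i + 2", unfolded axial2, folded y_def \<open>z (i + 4) = _\<close>]
    obtain \<nu> where \<nu>: "A2 y = \<nu> * (snd (z i) * snd (z (i + 4)))"
      "- B2 y = \<nu> * (fst (z i) * snd (z (i + 4)) + snd (z i) * fst (z (i + 4)))"
      "C2 y = \<nu> * (fst (z i) * fst (z (i + 4)))"
      using polar_neighbours[OF path2' w(1)[OF nd(4), of i] A2_def B2' C2_def] by blast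
    have "axial3 b h (A2 y) (- B2 y) (C2 y) = heptagon b h * theta b h y"
      using axial_theta[OF R_def A2_def B2_def C2_def] by (simp add: heptagon_def R_def)
    then have "\<nu>\<^sup>2 * polar (axial3 b h) (z i) (z (i + 4)) = heptagon b h * theta b h (z (i + 2))"
      using qform_polar[OF \<nu>] by (simp add: ax3 y_def)
    \<comment> \<open>Needed only for the four-step condition; the claim on \<open>theta\<close>
      follows even if \<open>\<nu>\<close> vanishes.\<close>
    moreover have "\<nu> \<noteq> 0" if "heptagon b h = 0" "R \<noteq> 0"
      using axial2_rows_nonzero[OF that(1) assms(3) that(2) R_def, of y] \<nu> z0[of "i + 2"]
      by (auto simp: A2_def B2_def C2_def y_def)
    ultimately have "\<nu>\<^sup>2 * polar (axial3 b h) (z i) (z (i + 4)) = heptagon b h * theta b h (z (i + 2))"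
     "heptagon b h = 0 \<Longrightarrow> R \<noteq> 0 \<Longrightarrow> \<nu> \<noteq> 0" by blast+
    then have "\<exists>\<nu>. \<nu>\<^sup>2 * polar (axial3 b h) (z i) (z (i + 4)) = heptagon b h * theta b h (z (i + 2)) \<and>
       (heptagon b h = 0 \<longrightarrow> R \<noteq> 0 \<longrightarrow> \<nu> \<noteq> 0)" by blast
  } note four = this
  show "polar (axial3 b h) (z i) (z (i + 4)) = 0" if "heptagon b h = 0" "1 - b^2 \<noteq> 0"
    using four[of i] that unfolding R_def by auto
  show "heptagon b h * theta b h (z (i + 2)) = 0" if "n = 7"
  proof -
    have "z (i + 4 + 3) = z i" using path that by (simp add: poncelet_cycle_def add.assoc)
    then show ?thesis using four[of i] path3[of "i + 4"] polar_commute[of _ "z i" "z (i + 4)"] by auto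
  qed
qed

text \<open>Now \<open>axial3\<close> relates \<open>z (i + 4)\<close> to the vertices three and
  four steps away on either side. Unless \<open>n = 7\<close>, at least three of these four are
  distinct, so the binary form at every \<open>z (i + 4)\<close> vanishes identically.\<close>

lemma axial_path_heptagon_eq_7:
  assumes path: "poncelet_cycle (axial1 b h) n z" and n: "5 \<le> n"
    and "b \<noteq> 0" "h \<noteq> 0" "1 - b^2 \<noteq> 0" "(1 - b^2)^2 \<noteq> b * h"
    and "heptagon b h = 0"
  shows "n = 7"
proof (rule ccontr)
  assume n7: "n \<noteq> 7"
  define R where "R = 1 - b^2"
  note w = poncelet_cycle_wedge[OF path]
  \<comment> \<open>Only the first coefficient is kept explicit, since the hypotheses make it
    nonzero.\<close>
  obtain a1 a2 a3 a4 a5 where ax3: "axial3 b h = qform (b * R^2 * (R^2 - b * h)) a1 a2 a3 a4 a5"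
    unfolding axial3_def R_def Let_def by blast
  have "\<not> n dvd 7"
  proof
    assume "n dvd 7"
    then have "n \<le> 7" by (auto dest: dvd_imp_le)
    with n n7 have "n = 5 \<or> n = 6" by auto
    with \<open>n dvd 7\<close> show False by auto
  qed
  have root: "binary_form a2 a1 (b * R^2 * (R^2 - b * h)) (z (i + 4)) = 0" for i
  proof -
    let ?y = "z (i + 4)"
    let ?A = "binary_form a4 a3 a2 ?y" and ?B = "binary_form a3 (a5 + 2 * a2) a1 ?y" and ?C = "binary_form a2 a1 (b * R^2 * (R^2 - b * h)) ?y"
    have r: "binary_form ?A ?B ?C x = 0" if "polar (axial3 b h) ?y x = 0" for x
      using that by (simp add: ax3 polar_qform)
    note p3 = axial_path_3[OF path n assms(3,4)]
    note p4 = axial_path_4[OF path n assms(3,4) assms(7,5)]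
    have roots: "polar (axial3 b h) ?y (z i) = 0" "polar (axial3 b h) ?y (z (i + 1)) = 0"
      "polar (axial3 b h) ?y (z (i + 7)) = 0" "polar (axial3 b h) ?y (z (i + 8)) = 0"
      using p4[of i] p3[of "i + 1"] p3[of "i + 4"] p4[of "i + 4"] polar_commute[of _ ?y]
      by (simp_all add: add.commute add.left_commute)
    note roots = roots[THEN r]
    have nd: "\<not> n dvd 1" using n by auto
    have w1: "wedge (z i) (z (i + 1)) \<noteq> 0" "wedge (z (i + 7)) (z (i + 8)) \<noteq> 0"
      "wedge (z i) (z (i + 7)) \<noteq> 0" "wedge (z (i + 1)) (z (i + 8)) \<noteq> 0"
      using w(1)[OF nd, of i] w(1)[OF nd, of "i + 7"] w(1)[OF \<open>\<not> n dvd 7\<close>, of i] w(1)[OF \<open>\<not> n dvd 7\<close>, of "i + 1"]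
      by (simp_all only: add.assoc one_add_one numeral_plus_one one_plus_numeral arith_simps add_num_simps not_False_eq_True)
    show "?C = 0"
    proof (cases "n = 6")
      case True
      have "wedge (z i) (z (i + 8)) \<noteq> 0" using w(1)[of 8 i] True by simp
      with w1 show ?thesis using binary_three_roots(3)[OF roots(1,3,4)] by blast
    next
      case False
      have "\<not> n dvd 6"
      proof
        assume "n dvd 6"
        then have "n \<le> 6" by (auto dest: dvd_imp_le)
        with n False have "n = 5" by simp
        with \<open>n dvd 6\<close> show False by simp
      qed
      then have "wedge (z (i + 1)) (z (i + 7)) \<noteq> 0" using w(1)[of 6 "i + 1"]
        by (simp only: add.assoc one_plus_numeral add_num_simps not_False_eq_True)
      with w1 show ?thesis using binary_three_roots(3)[OF roots(2,3,4)] by blast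
    qed
  qed
  have "\<not> n dvd 1" "\<not> n dvd 2" using n by (auto dest: dvd_imp_le)
  then have "wedge (z 4) (z 5) \<noteq> 0" "wedge (z 4) (z 6) \<noteq> 0" "wedge (z 5) (z 6) \<noteq> 0"
    using w(1)[of 1 4] w(1)[of 2 4] w(1)[of 1 5] by simp_all
  moreover have "binary_form a2 a1 (b * R^2 * (R^2 - b * h)) (z 4) = 0"
    "binary_form a2 a1 (b * R^2 * (R^2 - b * h)) (z 5) = 0" "binary_form a2 a1 (b * R^2 * (R^2 - b * h)) (z 6) = 0"
    using root[of 0] root[of 1] root[of 2] by simp_all
  ultimately have "b * R^2 * (R^2 - b * h) = 0" by (metis binary_three_roots(3))
  then show False using assms by (simp add: R_def)
qed

text \<open>Otherwise the quartic \<open>theta\<close> would vanish at seven distinct points; its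
  leading coefficient is nonzero by hypothesis.\<close>

lemma axial_path_7_imp_heptagon:
  assumes path: "poncelet_cycle (axial1 b h) 7 z"
    and "b \<noteq> 0" "h \<noteq> 0" "(1 - b^2)^2 \<noteq> - b * h"
  shows "heptagon b h = 0"
proof (rule ccontr)
  assume "heptagon b h \<noteq> 0"
  then have theta: "theta b h (z (i + 2)) = 0" for i
    using axial_path_theta[OF path _ assms(2,3), of i] by simp
  define t0 t1 t2 t3 t4 where "t0 = b * ((1 - b^2)^2 + b * h)"
    and "t1 = 2 * (1 - b^2)^2 - 2 * b^2 * h^2 + 4 * b^3 * h"
    and "t2 = h * (b^2 * h^2 + 4 * b^2 + 3 * b^4 - 1)"
    and "t3 = - 2 * (1 - b^2)^2 + 2 * b^2 * h^2 + 4 * b^3 * h"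
    and "t4 = - b * ((1 - b^2)^2 - b * h)"
  have t: "theta b h x = t0 * fst x^4 + t1 * fst x^3 * snd x + t2 * fst x^2 * snd x^2
    + t3 * fst x * snd x^3 + t4 * snd x^4" for x
    unfolding theta_def t0_def t1_def t2_def t3_def t4_def by simp
  have "t0 \<noteq> 0" using assms(2,4) by (auto simp: t0_def add_eq_0_iff2)
  define q where "q = [:t4, t3, t2, t1, t0:]"
  define f where "f i = fst (z (i + 2)) / snd (z (i + 2))" for i
  have w: "wedge (z (i + 2)) (z (j + 2)) \<noteq> 0" if "i \<in> {..<7}" "j \<in> {..<7}" "i \<noteq> j" for i j
  proof -
    have "(i + 2) mod 7 \<noteq> (j + 2) mod 7"
    proof
      \<comment> \<open>Adding 5 completes the shift by 2 to a full period.\<close>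
      assume "(i + 2) mod 7 = (j + 2) mod 7"
      then have "(i + 2 + 5) mod 7 = (j + 2 + 5) mod 7" by (metis mod_add_left_eq)
      with that show False by simp
    qed
    with path show ?thesis by (simp add: poncelet_cycle_def)
  qed
  have nz: "snd (z (i + 2)) \<noteq> 0" for i
  proof
    assume 0: "snd (z (i + 2)) = 0"
    with theta[of i] t \<open>t0 \<noteq> 0\<close> have "fst (z (i + 2)) = 0" by simp
    with 0 poncelet_cycle_wedge(1)[OF path, of 1 "i + 2"] show False by (simp add: wedge_def)
  qed
  have "inj_on f {..<7}"
    by (rule inj_onI, rule ccontr) (use w nz in \<open>auto simp: f_def wedge_def field_simps\<close>)
  then have "card (f ` {..<7}) = 7" by (simp add: card_image)
  moreover have "f ` {..<7} \<subseteq> {x. poly q x = 0}"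
  proof clarify
    fix i
    have "snd (z (i + 2)) ^ 4 * poly q (f i) = theta b h (z (i + 2))"
      using nz[of i] unfolding t q_def f_def by (simp add: field_simps power2_eq_square power3_eq_cube power4_eq_xxxx)
    then show "poly q (f i) = 0" using theta[of i] nz[of i] by simp
  qed
  moreover have "q \<noteq> 0" using \<open>t0 \<noteq> 0\<close> by (simp add: q_def)
  ultimately have "7 \<le> degree q"
    by (metis card_mono card_poly_roots_bound le_trans poly_roots_finite)
  moreover have "degree q \<le> 4" unfolding q_def by (simp add: degree_pCons_le)
  ultimately show False by simp
qed

section \<open>Choosing a real parameter of the family that admits no cycle\<close>

lemma poncelet_cycle_axial:
  assumes "poncelet_cycle (side_form (\<i> * b) (- \<i> * b) r p) n z" "r \<noteq> 0"
  shows "poncelet_cycle (axial1 (b / r) (2 * \<i> * p / r)) n (\<lambda>i. (- \<i> * fst (z i), snd (z i)))"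
proof -
  have "wedge (- \<i> * fst x, snd x) (- \<i> * fst y, snd y) = - \<i> * wedge x y" for x y
    by (simp add: wedge_def algebra_simps)
  moreover have "polar (side_form (\<i> * b) (- \<i> * b) r p) x y =
    \<i> * r * polar (axial1 (b / r) (2 * \<i> * p / r)) (- \<i> * fst x, snd x) (- \<i> * fst y, snd y)" for x y
  proof -
    define b' p' where "b' = b / r" and "p' = p / r"
    have bp: "b = r * b'" "p = r * p'" using assms(2) by (simp_all add: b'_def p'_def)
    have h: "2 * \<i> * p / r = 2 * \<i> * p'" by (simp add: p'_def)
    have i2: "\<i> * \<i> = -1" by simp
    show ?thesis
      unfolding h b'_def[symmetric] unfolding bp polar_def side_form_def axial1_def qform_def fst_conv snd_conv
      using i2 by algebra
  qed
  ultimately show ?thesis using assms by (auto simp: poncelet_cycle_def)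
qed

text \<open>For real \<open>p\<close> the parameter \<open>h = 2ip/r\<close> is imaginary; with
  \<open>q = (2p/r)^2\<close> the condition becomes a real quadratic in \<open>q\<close>.\<close>

lemma heptagon_of_real:
  assumes "h\<^sup>2 = of_real (- q)"
  shows "heptagon (of_real \<beta>) h = of_real (\<beta>^6 * q\<^sup>2 - \<beta>\<^sup>2 * (1 - \<beta>\<^sup>2)^3 * q - (1 - \<beta>\<^sup>2)^6)"
proof -
  have "h^4 = (h\<^sup>2)\<^sup>2" by (simp add: power_mult[symmetric])
  then show ?thesis unfolding heptagon_def assms by simp
qed

text \<open>The product of the two roots is negative; \<open>q\<close> below is the larger
  one.\<close>

lemma exists_heptagon_root:
  fixes \<beta> \<rho> :: real
  assumes "\<beta> \<noteq> 0" "\<rho> \<noteq> 0"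
  shows "\<exists>q>0. \<beta>^6 * q\<^sup>2 - \<beta>\<^sup>2 * \<rho>^3 * q - \<rho>^6 = 0"
proof -
  define B where "B = \<beta>\<^sup>2 * \<rho>^3"
  define s where "s = sqrt (B\<^sup>2 + 4 * \<beta>^6 * \<rho>^6)"
  define q where "q = (B + s) / (2 * \<beta>^6)"
  have pos: "0 < \<beta>^6" "0 < \<rho>^6" using assms by (simp_all add: zero_less_power_eq)
  have s2: "s\<^sup>2 = B\<^sup>2 + 4 * \<beta>^6 * \<rho>^6" unfolding s_def using pos by simp
  have "\<bar>B\<bar> < s" unfolding s_def by (rule real_less_rsqrt) (use pos in simp)
  then have "0 < q" unfolding q_def using pos by simp
  moreover have "\<beta>^6 * q\<^sup>2 - B * q - \<rho>^6 = 0"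
  proof -
    have "2 * \<beta>^6 * q = B + s" using pos by (simp add: q_def)
    then have "4 * \<beta>^6 * (\<beta>^6 * q\<^sup>2 - B * q - \<rho>^6) = 0" using s2 by algebra
    with pos show ?thesis by simp
  qed
  ultimately show ?thesis unfolding B_def by blast
qed

lemma exists_heptagon_nonroot:
  fixes \<beta> s t :: real
  assumes "\<beta> \<noteq> 0"
  shows "\<exists>q>0. \<beta>^6 * q\<^sup>2 - s * q - t \<noteq> 0"
proof (rule ccontr)
  assume "\<not> ?thesis"
  then have "\<beta>^6 * q\<^sup>2 - s * q - t = 0" if "q > 0" for q using that by blast
  from this[of 1] this[of 2] this[of 3]
  have "\<beta>^6 - s - t = 0" "4 * \<beta>^6 - 2 * s - t = 0" "9 * \<beta>^6 - 3 * s - t = 0" by simp_all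
  then have "\<beta>^6 = 0" by linarith
  with assms show False by simp
qed

lemma no_poncelet_cycle:
  fixes a b r :: real
  assumes "r \<noteq> 0" "5 \<le> n"
  obtains p :: real where "p \<noteq> 0"
    "\<And>z. \<not> poncelet_cycle (side_form (Complex a b) (Complex a (- b)) (of_real r) (of_real p)) n z"
proof -
  let ?c = "Complex a b" and ?c' = "Complex a (- b)"
  have cc: "?c * ?c' = of_real (a\<^sup>2 + b\<^sup>2)" "?c + ?c' = of_real (2 * a)"
    by (simp_all add: complex_eq_iff power2_eq_square)
  consider "a\<^sup>2 + b\<^sup>2 = r\<^sup>2" | "a\<^sup>2 + b\<^sup>2 \<noteq> r\<^sup>2" "a = 0" "b = 0" | "a\<^sup>2 + b\<^sup>2 \<noteq> r\<^sup>2" "a \<noteq> 0"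
    | "b\<^sup>2 \<noteq> r\<^sup>2" "a = 0" "b \<noteq> 0" by fastforce
  then show thesis
  proof cases
    case 1
    show thesis
    proof (rule that[of 1])
      show "\<not> poncelet_cycle (side_form ?c ?c' (of_real r) (of_real 1)) n z" for z
        using side_form_zero_path[of ?c ?c' "of_real r" "of_real 1" n z] assms 1 by (auto simp: cc simp flip: of_real_power)
    qed simp
  next
    case 2
    show thesis
    proof (rule that[of 1])
      show "\<not> poncelet_cycle (side_form ?c ?c' (of_real r) (of_real 1)) n z" for z
        using side_form_involution_path[of ?c ?c' "of_real r" "of_real 1" n z 1 0 "-1"] assms 2
        by (auto simp: binary_form_def Complex_eq)
    qed simp
  next
    case 3
    define m where "m = a\<^sup>2 + b\<^sup>2"
    have m: "m \<noteq> 0" using 3 by (simp add: m_def sum_power2_eq_zero_iff)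
    show thesis
    \<comment> \<open>In the relation \<open>lin\<close> the coefficients of both squares cancel for
      every \<open>p\<close>; this \<open>p\<close> also cancels the mixed one.\<close>
    proof (rule that[of "a * (r\<^sup>2 - m) / m"])
      show "a * (r\<^sup>2 - m) / m \<noteq> 0" using 3 m by (simp add: m_def)
      have p: "of_real (2 * (a * (r\<^sup>2 - m) / m)) * (?c * ?c') = (?c + ?c') * ((of_real r)\<^sup>2 - ?c * ?c')"
        unfolding cc m_def[symmetric] of_real_mult[symmetric] of_real_power[symmetric] of_real_diff[symmetric]
        using m by (intro arg_cong[of _ _ of_real]) simp
      have lin: "of_real r * ?c * binary_form ?c' (of_real r) 0 y
          - (?c * ?c') * binary_form (of_real r) (?c + ?c' + 2 * of_real (a * (r\<^sup>2 - m) / m)) (of_real r) y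
          + of_real r * ?c' * binary_form 0 (of_real r) ?c y = 0" for y
        using p unfolding binary_form_def of_real_mult[of 2] of_real_numeral by algebra
      have cr: "?c * ?c' \<noteq> (of_real r)\<^sup>2" using 3 by (simp only: cc of_real_power[symmetric] of_real_eq_iff not_False_eq_True)
      have nd: "of_real r * ?c * (of_real r * ?c') \<noteq> (?c * ?c')\<^sup>2"
      proof
        assume "of_real r * ?c * (of_real r * ?c') = (?c * ?c')\<^sup>2"
        then have "(?c * ?c') * ((of_real r)\<^sup>2 - ?c * ?c') = 0" by algebra
        with cr m show False by (simp add: cc m_def del: of_real_add)
      qed
      show "\<not> poncelet_cycle (side_form ?c ?c' (of_real r) (of_real (a * (r\<^sup>2 - m) / m))) n z" for z
        using side_form_involution_path[OF _ assms(2) cr _ lin nd] assms by auto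
    qed
  next
    case 4
    define \<beta> where "\<beta> = b / r"
    define \<rho> where "\<rho> = 1 - \<beta>\<^sup>2"
    have \<beta>: "\<beta> \<noteq> 0" using 4 assms by (simp add: \<beta>_def)
    have \<rho>: "\<rho> \<noteq> 0" using 4 assms by (auto simp: \<rho>_def \<beta>_def power_divide)
    \<comment> \<open>If \<open>n \<noteq> 7\<close>, the equation must hold, as it forces length 7;
      if \<open>n = 7\<close>, it must fail.\<close>
    obtain q where q: "q > 0" "(\<beta>^6 * q\<^sup>2 - \<beta>\<^sup>2 * \<rho>^3 * q - \<rho>^6 = 0) \<longleftrightarrow> n \<noteq> 7"
      using exists_heptagon_root[OF \<beta> \<rho>] exists_heptagon_nonroot[OF \<beta>] by (cases "n = 7") metis+
    define h where "h = \<i> * of_real (sqrt q)"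
    have h2: "h\<^sup>2 = of_real (- q)" using q(1) by (simp add: h_def power_mult_distrib flip: of_real_power)
    have hep: "heptagon (of_real \<beta>) h = 0 \<longleftrightarrow> n \<noteq> 7"
      unfolding heptagon_of_real[OF h2] using q(2) by (simp only: \<rho>_def of_real_eq_0_iff)
    have "h \<noteq> 0" using q(1) by (simp add: h_def)
    have R: "1 - (of_real \<beta>)\<^sup>2 = (of_real \<rho> :: complex)" by (simp add: \<rho>_def)
    \<comment> \<open>A real number differs from a nonzero imaginary one.\<close>
    have ne: "(1 - (of_real \<beta>)\<^sup>2)\<^sup>2 \<noteq> of_real \<beta> * h" "(1 - (of_real \<beta>)\<^sup>2)\<^sup>2 \<noteq> - of_real \<beta> * h"
      unfolding R using \<beta> q(1) by (auto simp: h_def complex_eq_iff Re_power2 Im_power2)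
    show thesis
    proof (rule that[of "r * sqrt q / 2"], goal_cases)
      case 1
      then show ?case using assms q(1) by simp
    next
      case (2 z)
      show ?case
      proof
        assume "poncelet_cycle (side_form ?c ?c' (of_real r) (of_real (r * sqrt q / 2))) n z"
        then have "poncelet_cycle (side_form (\<i> * of_real b) (- \<i> * of_real b) (of_real r) (of_real (r * sqrt q / 2))) n z"
          using 4 by (simp add: Complex_eq)
        from poncelet_cycle_axial[OF this]
        obtain z' where z': "poncelet_cycle (axial1 (of_real \<beta>) h) n z'"
          using assms by (force simp: \<beta>_def h_def)
        have "1 - (of_real \<beta> :: complex)\<^sup>2 \<noteq> 0" using \<rho> R by simp
        show False
        proof (cases "n = 7")
          case True
          then show False using axial_path_7_imp_heptagon[of "of_real \<beta>" h z'] z' \<beta> \<open>h \<noteq> 0\<close> ne hep by auto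
        next
          case False
          then show False using axial_path_heptagon_eq_7[OF z' assms(2)] \<beta> \<open>h \<noteq> 0\<close> ne \<rho> R hep by auto
        qed
      qed
    qed
  qed
qed

section \<open>From polygons to cycles\<close>

lemma bilin_3: "bilin u v = u $ 1 * v $ 1 + u $ 2 * v $ 2 + u $ 3 * v $ 3"
  by (simp add: bilin_def sum_3)

lemma cp2_exhaust:
  obtains v where "v \<noteq> 0" "P = abs_cp2 v"
  by (induction P rule: cp2.abs_induct) (auto simp: proportional_def)

lemma abs_cp2_eq_iff:
  assumes "u \<noteq> 0" "v \<noteq> 0"
  shows "abs_cp2 u = abs_cp2 v \<longleftrightarrow> (\<exists>c. c \<noteq> 0 \<and> v = c *s u)"
proof -
  have refl: "proportional w w" if "w \<noteq> 0" for w
    using that by (auto simp: proportional_def intro!: exI[of _ 1])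
  show ?thesis using Quotient_rel[OF Quotient_cp2, of u v] refl[OF assms(1)] refl[OF assms(2)] assms
    by (simp add: proportional_def)
qed

lemma on_line_abs: "v \<noteq> 0 \<Longrightarrow> on_line l (abs_cp2 v) \<longleftrightarrow> bilin l v = 0"
  by (rule on_line.abs_eq) (auto simp: proportional_def intro!: exI[of _ 1])

lemma conjugate_abs: "u \<noteq> 0 \<Longrightarrow> v \<noteq> 0 \<Longrightarrow> conjugate_wrt A (abs_cp2 u) (abs_cp2 v) \<longleftrightarrow> bilin (A *v u) v = 0"
  by (rule conjugate_wrt.abs_eq) (auto simp: proportional_def intro!: exI[of _ 1])

text \<open>In the affine chart this is the point with \<open>x + iy = a + ib + rt\<close> and
  \<open>x - iy = a - ib + r/t\<close>, where \<open>t = z\<^sub>1/z\<^sub>2\<close>.\<close>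

definition circle_point :: "complex \<Rightarrow> complex \<Rightarrow> complex \<Rightarrow> complex \<times> complex \<Rightarrow> complex^3" where
  "circle_point a b r z = vector [a * (fst z * snd z) + r * (fst z ^ 2 + snd z ^ 2) / 2,
     b * (fst z * snd z) - \<i> * r * (fst z ^ 2 - snd z ^ 2) / 2, fst z * snd z]"

definition chord :: "complex \<Rightarrow> complex \<Rightarrow> complex \<Rightarrow> complex \<times> complex \<Rightarrow> complex \<times> complex \<Rightarrow> complex^3" where
  "chord a b r z w = vector [snd z * snd w + fst z * fst w, \<i> * (snd z * snd w - fst z * fst w),
     - ((a + \<i> * b) * (snd z * snd w) + (a - \<i> * b) * (fst z * fst w) + r * (fst z * snd w + snd z * fst w))]"

lemma circle_point_simps:
  "2 * circle_point a b r z $ 1 = 2 * a * (fst z * snd z) + r * (fst z ^ 2 + snd z ^ 2)"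
  "2 * circle_point a b r z $ 2 = 2 * b * (fst z * snd z) - \<i> * r * (fst z ^ 2 - snd z ^ 2)"
  "circle_point a b r z $ 3 = fst z * snd z"
  by (simp_all add: circle_point_def field_simps)

text \<open>Incidence with the chord, as a form in \<open>v\<close>, factors with zeros
  \<open>z\<close> and \<open>w\<close>; this settles which vertices lie on which sides.\<close>

lemma bilin_chord_circle_point:
  "bilin (chord a b r z w) (circle_point a b r v) = r * wedge z v * wedge w v"
proof -
  have i: "\<i> * \<i> = -1" by simp
  have "2 * bilin (chord a b r z w) (circle_point a b r v) = chord a b r z w $ 1 * (2 * circle_point a b r v $ 1)
    + chord a b r z w $ 2 * (2 * circle_point a b r v $ 2) + 2 * chord a b r z w $ 3 * circle_point a b r v $ 3"
    unfolding bilin_3 by algebra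
  also have "\<dots> = 2 * (r * wedge z v * wedge w v)"
    unfolding circle_point_simps unfolding chord_def wedge_def vector_3 using i by algebra
  finally show ?thesis by simp
qed

lemma circle_point_nonzero:
  assumes "r \<noteq> 0" "z \<noteq> (0, 0)"
  shows "circle_point a b r z \<noteq> 0"
proof
  assume "circle_point a b r z = 0"
  then have "circle_point a b r z $ i = 0" for i by simp
  from this[of 1] this[of 3] have "fst z * snd z = 0" "r * (fst z ^ 2 + snd z ^ 2) = 0"
    using circle_point_simps(1,3)[of a b r z] by auto
  with assms show False by (auto simp: prod_eq_iff)
qed

lemma circle_point_wedge_zero:
  assumes "wedge z w = 0" "z \<noteq> (0, 0)" "w \<noteq> (0, 0)"
  shows "\<exists>c. c \<noteq> 0 \<and> circle_point a b r w = c *s circle_point a b r z"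
proof -
  obtain k where k: "k \<noteq> 0" "fst w = k * fst z" "snd w = k * snd z"
  proof (cases "fst z = 0")
    case True
    then show ?thesis using assms that[of "snd w / snd z"] by (auto simp: wedge_def prod_eq_iff)
  next
    case False
    then have "snd w = fst w / fst z * snd z" using assms(1) by (simp add: wedge_def field_simps)
    with False show ?thesis using assms(3) that[of "fst w / fst z"] by (auto simp: prod_eq_iff)
  qed
  show ?thesis
    by (rule exI[of _ "k\<^sup>2"]) (simp add: k circle_point_def vec_eq_iff forall_3 power_mult_distrib algebra_simps power2_eq_square)
qed

lemma abs_circle_point_eq_iff:
  assumes "r \<noteq> 0" "z \<noteq> (0, 0)" "w \<noteq> (0, 0)"
  shows "abs_cp2 (circle_point a b r z) = abs_cp2 (circle_point a b r w) \<longleftrightarrow> wedge z w = 0"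
proof -
  note nz = circle_point_nonzero[OF assms(1,2)] circle_point_nonzero[OF assms(1,3)]
  have "wedge z w = 0" if "circle_point a b r w = c *s circle_point a b r z" for c
  proof -
    \<comment> \<open>Both points are paired with the tangent \<open>chord a b r z z\<close>, which
      meets the circle only at the point of \<open>z\<close>.\<close>
    have "r * wedge z w * wedge z w = c * (r * wedge z z * wedge z z)"
      by (metis that bilin_chord_circle_point bilin_smult(2))
    then show ?thesis using assms(1) by (simp add: wedge_def mult.commute)
  qed
  then show ?thesis unfolding abs_cp2_eq_iff[OF nz]
    using circle_point_wedge_zero[OF _ assms(2,3)] by blast
qed

lemma circle_mult:
  "complexify (circle a b r) *v v = vector [v $ 1 - a * v $ 3, v $ 2 - b * v $ 3,
     - a * v $ 1 - b * v $ 2 + (a\<^sup>2 + b\<^sup>2 - r\<^sup>2) * v $ 3]"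
  by (simp add: complexify_def circle_def matrix_vector_mult_def vec_eq_iff forall_3 sum_3)

lemma bilin_circle:
  "bilin (complexify (circle a b r) *v v) v = (v $ 1 - a * v $ 3)\<^sup>2 + (v $ 2 - b * v $ 3)\<^sup>2 - (r * v $ 3)\<^sup>2"
  unfolding circle_mult bilin_3 vector_3 by algebra

lemma circle_point_on_circle:
  assumes "r \<noteq> 0" "z \<noteq> (0, 0)"
  shows "on_conic (complexify (circle a b r)) (abs_cp2 (circle_point (of_real a) (of_real b) (of_real r) z))"
proof -
  have i: "\<i> * \<i> = -1" by simp
  have r: "of_real r \<noteq> (0::complex)" using assms by simp
  let ?v = "circle_point (of_real a) (of_real b) (of_real r) z"
  have "4 * bilin (complexify (circle a b r) *v ?v) ?v = (2 * ?v $ 1 - 2 * of_real a * ?v $ 3)\<^sup>2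
    + (2 * ?v $ 2 - 2 * of_real b * ?v $ 3)\<^sup>2 - (2 * of_real r * ?v $ 3)\<^sup>2"
    unfolding bilin_circle by algebra
  also have "\<dots> = 0"
    unfolding circle_point_simps using i by algebra
  finally have "bilin (complexify (circle a b r) *v ?v) ?v = 0" by simp
  then show ?thesis unfolding on_conic_def
    using conjugate_abs circle_point_nonzero[OF r assms(2)] by simp
qed

lemma on_circle_obtain:
  assumes "r \<noteq> 0" "on_conic (complexify (circle a b r)) P"
  obtains z where "z \<noteq> (0, 0)" "P = abs_cp2 (circle_point (of_real a) (of_real b) (of_real r) z)"
proof -
  have i: "\<i> * \<i> = -1" by simp
  obtain v where v: "v \<noteq> 0" "P = abs_cp2 v" using cp2_exhaust by blast
  have r: "of_real r \<noteq> (0::complex)" using assms by simp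
  let ?r = "of_real r :: complex" and ?a = "of_real a :: complex" and ?b = "of_real b :: complex"
  have eq: "(v $ 1 - ?a * v $ 3)\<^sup>2 + (v $ 2 - ?b * v $ 3)\<^sup>2 = (?r * v $ 3)\<^sup>2"
    using assms(2) v by (simp add: on_conic_def conjugate_abs bilin_circle)
  \<comment> \<open>Isotropic coordinates relative to the centre, divided by the radius; for a
    \<open>circle_point\<close> they are the squares of the two parameters.\<close>
  define \<xi> where "\<xi> = ((v $ 1 - ?a * v $ 3) + \<i> * (v $ 2 - ?b * v $ 3)) / ?r"
  define \<eta> where "\<eta> = ((v $ 1 - ?a * v $ 3) - \<i> * (v $ 2 - ?b * v $ 3)) / ?r"
  have xi: "?r * \<xi> = (v $ 1 - ?a * v $ 3) + \<i> * (v $ 2 - ?b * v $ 3)"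
    "?r * \<eta> = (v $ 1 - ?a * v $ 3) - \<i> * (v $ 2 - ?b * v $ 3)"
    using r by (simp_all add: \<xi>_def \<eta>_def)
  have "?r\<^sup>2 * (\<xi> * \<eta>) = (?r * \<xi>) * (?r * \<eta>)" by algebra
  also have "\<dots> = ?r\<^sup>2 * (v $ 3)\<^sup>2" using eq i unfolding xi by algebra
  finally have "?r\<^sup>2 * (\<xi> * \<eta>) = ?r\<^sup>2 * (v $ 3)\<^sup>2" .
  then have prod: "\<xi> * \<eta> = (v $ 3)\<^sup>2" using r by simp
  obtain z1 z2 where z: "z1\<^sup>2 = \<xi>" "z2\<^sup>2 = \<eta>" "z1 * z2 = v $ 3"
  proof -
    \<comment> \<open>The sign of one square root is adjusted so that the product of the roots is
      the third coordinate.\<close>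
    have "(csqrt \<xi> * csqrt \<eta>)\<^sup>2 = (v $ 3)\<^sup>2" using prod by (simp add: power_mult_distrib)
    then consider "csqrt \<xi> * csqrt \<eta> = v $ 3" | "csqrt \<xi> * (- csqrt \<eta>) = v $ 3"
      by (auto simp: power2_eq_iff)
    then show thesis using that[of "csqrt \<xi>" "csqrt \<eta>"] that[of "csqrt \<xi>" "- csqrt \<eta>"] by cases auto
  qed
  have pt: "circle_point ?a ?b ?r (z1, z2) = v"
  proof -
    have "2 * v $ 1 = 2 * (?a * v $ 3) + ?r * (\<xi> + \<eta>)" "2 * v $ 2 = 2 * (?b * v $ 3) - \<i> * ?r * (\<xi> - \<eta>)"
      using xi i by algebra+
    then have "v $ 1 = ?a * v $ 3 + ?r * (\<xi> + \<eta>) / 2" "v $ 2 = ?b * v $ 3 - \<i> * ?r * (\<xi> - \<eta>) / 2"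
      by (simp_all add: field_simps)
    then show ?thesis by (simp add: circle_point_def vec_eq_iff forall_3 z)
  qed
  moreover have "(z1, z2) \<noteq> (0, 0)" using pt v(1) by (auto simp: circle_point_def vec_eq_iff forall_3)
  ultimately show thesis using that[of "(z1, z2)"] v(2) by simp
qed

text \<open>Restricted to the parametrised circle, \<open>l\<close> is a binary quadratic form with
  zeros \<open>z\<close> and \<open>w\<close>. Vieta determines it up to a factor, and
  \<open>l\<close> can be recovered from its coefficients.\<close>

lemma line_eq_chord:
  assumes "bilin l (circle_point a b r z) = 0" "bilin l (circle_point a b r w) = 0"
    and "wedge z w \<noteq> 0" "r \<noteq> 0"
  shows "\<exists>k. l = k *s chord a b r z w"
proof -
  define A where "A = r * (l $ 1 - \<i> * l $ 2)"
  define B where "B = 2 * (a * l $ 1 + b * l $ 2 + l $ 3)"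
  define C where "C = r * (l $ 1 + \<i> * l $ 2)"
  have i: "\<i> * \<i> = -1" by simp
  have bin: "binary_form A B C v = 2 * bilin l (circle_point a b r v)" for v
  proof -
    have "2 * bilin l (circle_point a b r v) = l $ 1 * (2 * circle_point a b r v $ 1)
      + l $ 2 * (2 * circle_point a b r v $ 2) + 2 * l $ 3 * circle_point a b r v $ 3"
      unfolding bilin_3 by algebra
    then show ?thesis unfolding circle_point_simps binary_form_def A_def B_def C_def by algebra
  qed
  obtain \<nu> where \<nu>: "A = \<nu> * (snd z * snd w)" "- B = \<nu> * (fst z * snd w + snd z * fst w)"
    "C = \<nu> * (fst z * fst w)"
    using binary_two_roots[of A B C z w] assms(1-3) by (auto simp: bin)
  have l1: "2 * r * l $ 1 = \<nu> * (snd z * snd w + fst z * fst w)"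
    using \<nu> unfolding A_def C_def by algebra
  moreover have l2: "2 * r * l $ 2 = \<nu> * (\<i> * (snd z * snd w - fst z * fst w))"
    using \<nu> i unfolding A_def C_def by algebra
  moreover have "2 * r * l $ 3 = \<nu> * (- ((a + \<i> * b) * (snd z * snd w) + (a - \<i> * b) * (fst z * fst w)
      + r * (fst z * snd w + snd z * fst w)))"
  proof -
    have "2 * r * l $ 3 = r * B - a * (2 * r * l $ 1) - b * (2 * r * l $ 2)"
      unfolding B_def by algebra
    moreover have "B = - \<nu> * (fst z * snd w + snd z * fst w)" using \<nu>(2) by algebra
    ultimately show ?thesis using l1 l2 by algebra
  qed
  ultimately have "l = (\<nu> / (2 * r)) *s chord a b r z w"
    using assms(4) by (simp add: chord_def vec_eq_iff forall_3 field_simps)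
  then show ?thesis ..
qed

section \<open>Tangent lines of the parabola\<close>

lemma parabola_mult:
  "complexify (parabola p) *v v = vector [- p * v $ 3, v $ 2, - p * v $ 1 - p\<^sup>2 * v $ 3]"
  by (simp add: complexify_def parabola_def matrix_vector_mult_def vec_eq_iff forall_3 sum_3)

text \<open>The dual conic: for \<open>p \<noteq> 0\<close>, its matrix is \<open>p\<close> times
  the inverse of the matrix of the parabola.\<close>

definition dual_parabola :: "complex \<Rightarrow> complex^3 \<Rightarrow> complex" where
  "dual_parabola p l = p * ((l $ 1)\<^sup>2 + (l $ 2)\<^sup>2) - 2 * l $ 1 * l $ 3"

lemma dual_parabola_scale: "dual_parabola p (k *s l) = k\<^sup>2 * dual_parabola p l"
  unfolding dual_parabola_def vector_smult_component by algebra

lemma dual_parabola_mult: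
  "dual_parabola (of_real p) (complexify (parabola p) *v v) = p * bilin (complexify (parabola p) *v v) v"
  unfolding parabola_mult dual_parabola_def bilin_3 vector_3 by algebra

lemma dual_parabola_chord:
  "dual_parabola p (chord a b r z w) = 2 * polar (side_form (a + \<i> * b) (a - \<i> * b) r p) z w"
proof -
  have i: "\<i> * \<i> = -1" by simp
  show ?thesis
    unfolding dual_parabola_def chord_def polar_def side_form_def qform_def vector_3 using i by algebra
qed

lemma tangent_to_parabola_iff:
  assumes "p \<noteq> 0"
  shows "tangent_to L (complexify (parabola p)) \<longleftrightarrow>
    (\<exists>l. l \<noteq> 0 \<and> dual_parabola (of_real p) l = 0 \<and> L = {Q. on_line l Q})"
proof -
  let ?B = "complexify (parabola p)"
  have line: "tangent_line_at ?B (abs_cp2 u) = {Q. on_line (?B *v u) Q}" if "u \<noteq> 0" for u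
    unfolding tangent_line_at_def using that
    by (metis (no_types, lifting) Collect_cong conjugate_abs cp2_exhaust on_line_abs)
  have nz: "?B *v u \<noteq> 0" if "u \<noteq> 0" for u
    using that assms by (auto simp: parabola_mult vec_eq_iff forall_3)
  have conic: "on_conic ?B (abs_cp2 u) \<longleftrightarrow> dual_parabola (of_real p) (?B *v u) = 0" if "u \<noteq> 0" for u
    using that assms by (simp add: on_conic_def conjugate_abs dual_parabola_mult)
  show ?thesis
  proof
    assume "tangent_to L ?B"
    then obtain P where P: "on_conic ?B P" "L = tangent_line_at ?B P" by (auto simp: tangent_to_def)
    obtain u where u: "u \<noteq> 0" "P = abs_cp2 u" using cp2_exhaust by blast
    then show "\<exists>l. l \<noteq> 0 \<and> dual_parabola (of_real p) l = 0 \<and> L = {Q. on_line l Q}"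
      using P conic line nz by blast
  next
    assume "\<exists>l. l \<noteq> 0 \<and> dual_parabola (of_real p) l = 0 \<and> L = {Q. on_line l Q}"
    then obtain l where l: "l \<noteq> 0" "dual_parabola (of_real p) l = 0" "L = {Q. on_line l Q}" by blast
    \<comment> \<open>The point of contact, obtained by applying the inverse matrix to
      \<open>l\<close>.\<close>
    define u :: "complex^3" where "u = vector [l $ 1 - l $ 3 / p, l $ 2, - l $ 1 / p]"
    have u: "?B *v u = l" using assms
      by (simp add: parabola_mult u_def vec_eq_iff forall_3 field_simps power2_eq_square)
    then have "u \<noteq> 0" using l(1) by auto
    then show "tangent_to L ?B" unfolding tangent_to_def using l conic line u by metis
  qed
qed

lemma poncelet_cycle_mod:
  assumes "poncelet_cycle F n z"
  shows "z (i mod n) = z i"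
proof -
  have "z (i + k * n) = z i" for i k
  proof (induction k)
    case (Suc k)
    have "z (i + Suc k * n) = z (i + k * n + n)" by (simp add: algebra_simps)
    also have "\<dots> = z (i + k * n)" using assms unfolding poncelet_cycle_def by blast
    finally show ?case using Suc by simp
  qed simp
  from this[of "i mod n" "i div n"] show ?thesis by simp
qed

text \<open>Vertices correspond to parameters on the projective line, sides to chords of consecutive
  vertices, and tangency to the vanishing of \<open>dual_parabola\<close> on the chord.\<close>

lemma poncelet_pair_iff:
  assumes "3 \<le> n" "r \<noteq> 0" "p \<noteq> 0"
  shows "poncelet_pair n (complexify (circle a b r)) (complexify (parabola p)) \<longleftrightarrow>
    (\<exists>z. poncelet_cycle (side_form (Complex a b) (Complex a (- b)) (of_real r) (of_real p)) n z)"
proof -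
  let ?pt = "circle_point (of_real a) (of_real b) (of_real r)"
  let ?ch = "chord (of_real a) (of_real b) (of_real r)"
  let ?F = "side_form (Complex a b) (Complex a (- b)) (of_real r) (of_real p)"
  have r: "of_real r \<noteq> (0 :: complex)" using assms by simp
  have dual: "dual_parabola (of_real p) (?ch z w) = 2 * polar ?F z w" for z w
    by (simp add: dual_parabola_chord Complex_eq)
  show ?thesis
  proof
    assume "poncelet_pair n (complexify (circle a b r)) (complexify (parabola p))"
    then obtain V S where V: "inj_on V {..<n}" "\<And>i. i < n \<Longrightarrow> V i \<in> S i \<and> V (Suc i mod n) \<in> S i"
      "\<And>i. i < n \<Longrightarrow> on_conic (complexify (circle a b r)) (V i)"
      "\<And>i. i < n \<Longrightarrow> tangent_to (S i) (complexify (parabola p))"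
      unfolding poncelet_pair_def poncelet_polygon_def polygon_def by blast
    have "\<exists>z. z \<noteq> (0, 0) \<and> V (i mod n) = abs_cp2 (?pt z)" for i
    proof -
      have "i mod n < n" using assms(1) by simp
      from on_circle_obtain[OF assms(2) V(3)[OF this]] show ?thesis by metis
    qed
    then obtain w where w: "w i \<noteq> (0, 0)" "V (i mod n) = abs_cp2 (?pt (w i))" for i by metis
    \<comment> \<open>The parameters \<open>w i\<close> were chosen separately for each index and
      need not be periodic.\<close>
    define z where "z i = w (i mod n)" for i
    have z: "z i \<noteq> (0, 0)" "V (i mod n) = abs_cp2 (?pt (z i))" for i using w[of "i mod n"] by (simp_all add: z_def)
    have wedge: "wedge (z i) (z j) \<noteq> 0" if "i mod n \<noteq> j mod n" for i j
    proof -
      have "V (i mod n) \<noteq> V (j mod n)" using V(1) that assms(1) by (auto simp: inj_on_def)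
      then show ?thesis using abs_circle_point_eq_iff[OF r z(1) z(1)] by (auto simp: z(2))
    qed
    have "polar ?F (z i) (z (Suc i)) = 0" for i
    proof -
      define k where "k = i mod n"
      have k: "k < n" using assms(1) by (simp add: k_def)
      obtain l where l: "l \<noteq> 0" "dual_parabola (of_real p) l = 0" "S k = {Q. on_line l Q}"
        using V(4)[OF k] tangent_to_parabola_iff[OF assms(3)] by auto
      have "Suc k mod n = Suc i mod n" by (simp add: k_def mod_Suc_eq)
      then have "on_line l (V (i mod n))" "on_line l (V (Suc i mod n))"
        using V(2)[OF k] l(3) by (auto simp: k_def)
      then have "bilin l (?pt (z i)) = 0" "bilin l (?pt (z (Suc i))) = 0"
        using circle_point_nonzero[OF r z(1)] by (auto simp: z(2) on_line_abs)
      moreover have "i mod n \<noteq> Suc i mod n" using assms(1) by (auto simp: mod_Suc)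
      ultimately obtain k where "l = k *s ?ch (z i) (z (Suc i))"
        using line_eq_chord[OF _ _ wedge r] by metis
      then show ?thesis using l(1,2) by (auto simp: dual_parabola_scale dual)
    qed
    then show "\<exists>z. poncelet_cycle ?F n z"
      unfolding poncelet_cycle_def using wedge by (intro exI[of _ z]) (auto simp: z_def)
  next
    assume "\<exists>z. poncelet_cycle ?F n z"
    then obtain z where path: "poncelet_cycle ?F n z" by blast
    note w = poncelet_cycle_wedge[OF path]
    have nd: "\<not> n dvd 1" "\<not> n dvd 2" using assms(1) by (auto dest: dvd_imp_le)
    have z0: "z i \<noteq> (0, 0)" for i using w(1)[OF nd(1)] wedge_nonzero by blast
    have wedge: "wedge (z i) (z j) = 0 \<longleftrightarrow> i mod n = j mod n" for i j
      using path poncelet_cycle_mod[OF path, of i] poncelet_cycle_mod[OF path, of j]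
      by (auto simp: poncelet_cycle_def wedge_def mult.commute)
    define V where "V i = abs_cp2 (?pt (z i))" for i
    define S where "S i = {Q. on_line (?ch (z i) (z (Suc i))) Q}" for i
    have VS: "V k \<in> S i \<longleftrightarrow> i mod n = k mod n \<or> Suc i mod n = k mod n" for i k
      using r by (simp add: V_def S_def on_line_abs circle_point_nonzero[OF r z0] bilin_chord_circle_point wedge)
    \<comment> \<open>A zero vector would be incident with the third vertex \<open>V (i + 2)\<close>
      as well.\<close>
    have ch0: "?ch (z i) (z (Suc i)) \<noteq> 0" for i
    proof
      assume 0: "?ch (z i) (z (Suc i)) = 0"
      have "bilin 0 (?pt (z (i + 2))) = 0" by (simp add: bilin_3)
      then have "V (i + 2) \<in> S i"
        by (simp add: V_def S_def on_line_abs circle_point_nonzero[OF r z0] 0)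
      moreover have "wedge (z i) (z (i + 2)) \<noteq> 0" "wedge (z (Suc i)) (z (i + 2)) \<noteq> 0"
        using w(1)[OF nd(2), of i] w(1)[OF nd(1), of "Suc i"] by simp_all
      ultimately show False unfolding VS wedge by blast
    qed
    have "inj_on V {..<n}"
      by (rule inj_onI) (simp add: V_def abs_circle_point_eq_iff[OF r z0 z0] wedge)
    moreover have "inj_on S {..<n}"
    proof (rule inj_onI, rule ccontr)
      fix i j assume ij: "i \<in> {..<n}" "j \<in> {..<n}" "S i = S j" "i \<noteq> j"
      \<comment> \<open>A side contains only two vertices. So, modulo \<open>n\<close>,
        \<open>i\<close> is \<open>j + 1\<close> and \<open>i + 1\<close> is \<open>j\<close> or
        \<open>j + 1\<close>, which is impossible for \<open>n \<ge> 3\<close>.\<close>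
      have "V i \<in> S j" "V (Suc i) \<in> S j" using ij(3) VS by auto
      with ij have succ: "Suc j mod n = i mod n"
        and alt: "Suc i mod n = j mod n \<or> Suc i mod n = Suc j mod n" by (auto simp: VS)
      have "Suc (Suc j) mod n = Suc i mod n" by (metis succ mod_Suc_eq)
      moreover have "wedge (z j) (z (Suc (Suc j))) \<noteq> 0" "wedge (z (Suc j)) (z (Suc (Suc j))) \<noteq> 0"
        using w(1)[OF nd(2), of j] w(1)[OF nd(1), of "Suc j"] by simp_all
      ultimately show False using alt unfolding wedge by argo
    qed
    moreover have "is_line (S i)" for i unfolding is_line_def S_def using ch0 by blast
    moreover have "V i \<in> S i \<and> V (Suc i mod n) \<in> S i" for i by (simp add: VS)
    moreover have "on_conic (complexify (circle a b r)) (V i)" for i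
      unfolding V_def by (rule circle_point_on_circle[OF assms(2) z0])
    moreover have "tangent_to (S i) (complexify (parabola p))" for i
      unfolding tangent_to_parabola_iff[OF assms(3)] S_def using ch0[of i] path
      by (intro exI[of _ "?ch (z i) (z (Suc i))"]) (auto simp: dual poncelet_cycle_def)
    ultimately show "poncelet_pair n (complexify (circle a b r)) (complexify (parabola p))"
      unfolding poncelet_pair_def poncelet_polygon_def polygon_def
      using nondegenerate_circle[OF assms(2)] nondegenerate_parabola[OF assms(3)] assms(1) by blast
  qed
qed

section \<open>Triangles and quadrilaterals\<close>

text \<open>The vertices are the circular points at infinity and the focus: its isotropic lines and the line
  at infinity touch every parabola of the family.\<close>

lemma poncelet_cycle_3: "\<exists>z. poncelet_cycle (side_form (Complex 1 0) (Complex 1 (-0)) (of_real 1) (of_real p)) 3 z"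
proof -
  define z :: "nat \<Rightarrow> complex \<times> complex" where "z i = [(0, 1), (1, 0), (-1, 1)] ! (i mod 3)" for i
  have m: "i mod 3 = 0 \<or> i mod 3 = 1 \<or> i mod 3 = 2" for i :: nat by linarith
  have "poncelet_cycle (side_form (Complex 1 0) (Complex 1 (-0)) (of_real 1) (of_real p)) 3 z"
    unfolding poncelet_cycle_def
  proof (intro conjI allI impI)
    show "wedge (z i) (z j) \<noteq> 0" if "i mod 3 \<noteq> j mod 3" for i j
      using m[of i] m[of j] that by (auto simp: z_def wedge_def)
    show "polar (side_form (Complex 1 0) (Complex 1 (-0)) (of_real 1) (of_real p)) (z i) (z (Suc i)) = 0" for i
      using m[of i] by (elim disjE)
        (simp_all add: z_def mod_Suc polar_def side_form_def qform_def Complex_eq)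
    show "z (i + 3) = z i" for i by (simp add: z_def)
  qed
  then show ?thesis by blast
qed

lemma poncelet_cycle_4: "\<exists>z. poncelet_cycle (side_form (Complex 0 0) (Complex 0 (-0)) (of_real 1) (of_real p)) 4 z"
proof -
  txt \<open>The vertices are \<open>x\<close>, \<open>y\<close>, \<open>1/x\<close>, \<open>1/y\<close>, with \<open>xy = m\<close>. They are distinct for all real \<open>p\<close>
    as \<open>(1 + m)\<^sup>2/m\<close> is not real.\<close>
  define m :: complex where "m = 2 * \<i>"
  \<comment> \<open>The sum \<open>x + y\<close> for which the chord of \<open>x\<close> and
    \<open>y\<close> is tangent, given \<open>xy = m\<close>.\<close>
  define s where "s = - 2 * of_real p * m / (1 + m)"
  define d where "d = csqrt (s\<^sup>2 - 4 * m)"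
  define x where "x = (s + d) / 2"
  define y where "y = (s - d) / 2"
  have m0: "1 + m \<noteq> 0" "m \<noteq> 0" "m \<noteq> 1" by (simp_all add: m_def complex_eq_iff)
  have s: "s * (1 + m) + 2 * of_real p * m = 0" using m0 by (simp add: s_def)
  have d: "d\<^sup>2 = s\<^sup>2 - 4 * m" by (simp add: d_def)
  have sum: "x + y = s" by (simp add: x_def y_def field_simps)
  have "4 * (x * y) = (s + d) * (s - d)" by (simp add: x_def y_def)
  also have "\<dots> = 4 * m" using d by algebra
  finally have prod: "x * y = m" by simp
  have xy: "x \<noteq> y"
  proof
    assume "x = y"
    then have "s\<^sup>2 = 4 * m" using d by (simp add: x_def y_def)
    then have "4 * m * (1 + m)\<^sup>2 = (s * (1 + m))\<^sup>2" by (simp add: power_mult_distrib)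
    also have "s * (1 + m) = - (2 * of_real p * m)" using s by (simp add: add_eq_0_iff)
    finally have "4 * m * (1 + m)\<^sup>2 = 4 * m * ((of_real p)\<^sup>2 * m)"
      by (simp add: power2_eq_square mult.assoc)
    then have "(of_real p)\<^sup>2 * m = (1 + m)\<^sup>2" using m0(2) by simp
    then have "Re ((of_real p)\<^sup>2 * m) = Re ((1 + m)\<^sup>2)" by simp
    then show False by (simp add: m_def Re_power2 flip: of_real_power)
  qed
  \<comment> \<open>This separates \<open>x\<close> from \<open>1/x\<close> and \<open>y\<close>
    from \<open>1/y\<close>: for \<open>t = 1\<close> or \<open>t = -1\<close> the real part of
    \<open>(1 + m)^2\<close> would be 0, but it is -3.\<close>
  have one: "t\<^sup>2 \<noteq> 1" if "t\<^sup>2 - s * t + m = 0" for t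
  proof
    assume t: "t\<^sup>2 = 1"
    then have "s * t = 1 + m" using that by (simp add: algebra_simps)
    then have "(1 + m)\<^sup>2 = s * (1 + m) * t" by (simp add: power2_eq_square)
    also have "s * (1 + m) = - (2 * of_real p * m)" using s by (simp add: add_eq_0_iff)
    finally have "(1 + m)\<^sup>2 = - (2 * of_real p * m) * t" .
    moreover have "t = 1 \<or> t = -1" using t by (simp add: power2_eq_1_iff)
    ultimately have "Re ((1 + m)\<^sup>2) = 0" by (auto simp: m_def)
    then show False by (simp add: m_def Re_power2)
  qed
  have sq: "x\<^sup>2 \<noteq> 1" "y\<^sup>2 \<noteq> 1" by (rule one, simp add: sum[symmetric] prod[symmetric] power2_eq_square algebra_simps)+
  define z where "z i = [(x, 1), (y, 1), (1, x), (1, y)] ! (i mod 4)" for i :: nat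
  have mod: "i mod 4 = 0 \<or> i mod 4 = 1 \<or> i mod 4 = 2 \<or> i mod 4 = 3" for i :: nat by linarith
  have side: "polar (side_form (Complex 0 0) (Complex 0 (-0)) (of_real 1) (of_real p)) u v = 0"
    if "u = (x, 1) \<and> v = (y, 1) \<or> u = (y, 1) \<and> v = (1, x) \<or> u = (1, x) \<and> v = (1, y) \<or> u = (1, y) \<and> v = (x, 1)" for u v
  proof -
    \<comment> \<open>All four sides lead to this one equation.\<close>
    have "(x + y) * (1 + x * y) + 2 * of_real p * (x * y) = 0" using s by (simp add: sum prod)
    with that show ?thesis
      by (auto simp: polar_def side_form_def qform_def Complex_eq power2_eq_square algebra_simps)
  qed
  have "poncelet_cycle (side_form (Complex 0 0) (Complex 0 (-0)) (of_real 1) (of_real p)) 4 z"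
    unfolding poncelet_cycle_def
  proof (intro conjI allI impI)
    show "wedge (z i) (z j) \<noteq> 0" if "i mod 4 \<noteq> j mod 4" for i j
      using mod[of i] mod[of j] that xy sq prod m0
      by (auto simp: z_def wedge_def power2_eq_square mult.commute)
    show "polar (side_form (Complex 0 0) (Complex 0 (-0)) (of_real 1) (of_real p)) (z i) (z (Suc i)) = 0" for i
      by (rule side) (use mod[of i] in \<open>auto simp: z_def mod_Suc\<close>)
    show "z (i + 4) = z i" for i by (simp add: z_def)
  qed
  then show ?thesis by blast
qed

theorem theorem4p5:
  fixes n :: nat
  assumes "3 \<le> n"
  shows "(\<exists>a b r. 0 < r \<and> isoperiodic n confocal_parabolas (complexify (circle a b r)))
         \<longleftrightarrow> n \<in> {3, 4}"
proof
  assume "\<exists>a b r. 0 < r \<and> isoperiodic n confocal_parabolas (complexify (circle a b r))"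
  then obtain a b r where r: "0 < r"
    and iso: "isoperiodic n confocal_parabolas (complexify (circle a b r))" by blast
  show "n \<in> {3, 4}"
  proof (rule ccontr)
    assume "n \<notin> {3, 4}"
    with assms have "5 \<le> n" by auto
    then obtain p where "p \<noteq> 0"
      "\<And>z. \<not> poncelet_cycle (side_form (Complex a b) (Complex a (- b)) (of_real r) (of_real p)) n z"
      using no_poncelet_cycle[of r n a b] r by blast
    moreover from this(1) have "complexify (parabola p) \<in> confocal_parabolas"
      by (auto simp: confocal_parabolas_def)
    ultimately show False
      using iso poncelet_pair_iff[OF assms, of r p a b] r unfolding isoperiodic_def by blast
  qed
next
  have iso: "isoperiodic n confocal_parabolas (complexify (circle a b 1))"
    if "\<And>p. \<exists>z. poncelet_cycle (side_form (Complex a b) (Complex a (- b)) (of_real 1) (of_real p)) n z"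
    for a b
    unfolding isoperiodic_def confocal_parabolas_def
    using that nondegenerate_circle[of 1] nondegenerate_parabola poncelet_pair_iff[OF assms] by auto
  assume "n \<in> {3, 4}"
  then consider "n = 3" | "n = 4" by auto
  then show "\<exists>a b r. 0 < r \<and> isoperiodic n confocal_parabolas (complexify (circle a b r))"
  proof cases
    case 1
    \<comment> \<open>A circle through the focus.\<close>
    then have "isoperiodic n confocal_parabolas (complexify (circle 1 0 1))"
      by (intro iso) (simp only: poncelet_cycle_3)
    then show ?thesis by (meson zero_less_one)
  next
    case 2
    \<comment> \<open>A circle centred at the focus.\<close>
    then have "isoperiodic n confocal_parabolas (complexify (circle 0 0 1))"
      by (intro iso) (simp only: poncelet_cycle_4)
    then show ?thesis by (meson zero_less_one)
  qed
qed

end
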